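(* \textsc{Shortest Self-Deleting $s$-$t$-path} can be solved (deterministically) in $2^{O(k\log(k\mu))}(n+m)\log n$ time.
   Context: All graphs are finite, simple and undirected; $n=|V(G)|$, $m=|E(G)|$. A self-deleting graph is a pair $(G,f)$ where $G=(V,E)$ is a graph and $f\colon V\to 2^{E}$ (the edges in $f(v)$ need not be incident to $v$). A path $(v_1,e_1,v_2,\dots,e_{k-1},v_k)$ in $G$ (with $e_i=\{v_i,v_{i+1}\}$) is $f$-conforming if $e_i\notin f(v_j)$ for all $j\le i$. Let $\mu=\max_{v\in V}|f(v)|$; when $\mu$ appears in a logarithm it stands for $\max\{\mu,2\}$. In \textsc{Shortest Self-Deleting $s$-$t$-path}, the input is $(G,f)$, vertices $s,t\in V(G)$ and a positive integer $k$, and the question is whether $G$ contains an $f$-conforming $s$-$t$ path on at most $k$ vertices. *)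

theory Defs
  imports Complex_Main
begin

section \<open>Self-deleting graphs\<close>

definition simple_graph :: "'a set \<Rightarrow> 'a set set \<Rightarrow> bool" where
  "simple_graph V E \<longleftrightarrow> finite V \<and> (\<forall>e\<in>E. e \<subseteq> V \<and> card e = 2)"

definition self_deleting_graph :: "'a set \<Rightarrow> 'a set set \<Rightarrow> ('a \<Rightarrow> 'a set set) \<Rightarrow> bool" where
  "self_deleting_graph V E f \<longleftrightarrow> simple_graph V E \<and> (\<forall>v\<in>V. f v \<subseteq> E)"

text \<open>Graphs are simple, so a path is determined by its sequence of vertices.\<close>

definition is_path :: "'a set \<Rightarrow> 'a set set \<Rightarrow> 'a list \<Rightarrow> bool" where
  "is_path V E p \<longleftrightarrow>
     p \<noteq> [] \<and> distinct p \<and> set p \<subseteq> V \<and>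
     (\<forall>i. Suc i < length p \<longrightarrow> {p ! i, p ! Suc i} \<in> E)"

definition conforming :: "('a \<Rightarrow> 'a set set) \<Rightarrow> 'a list \<Rightarrow> bool" where
  "conforming f p \<longleftrightarrow>
     (\<forall>i j. Suc i < length p \<and> j \<le> i \<longrightarrow> {p ! i, p ! Suc i} \<notin> f (p ! j))"

definition has_short_conforming_path ::
  "'a set \<Rightarrow> 'a set set \<Rightarrow> ('a \<Rightarrow> 'a set set) \<Rightarrow> 'a \<Rightarrow> 'a \<Rightarrow> nat \<Rightarrow> bool" where
  "has_short_conforming_path V E f s t k \<longleftrightarrow>
     (\<exists>p. is_path V E p \<and> conforming f p \<and> hd p = s \<and> last p = t \<and> length p \<le> k)"

definition max_deletions :: "'a set \<Rightarrow> ('a \<Rightarrow> 'a set set) \<Rightarrow> nat" where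
  "max_deletions V f = Max ((\<lambda>v. card (f v)) ` V)"

section \<open>Word RAM programs\<close>

text \<open>
  The machine has registers and zero-initialised arrays of words, indexed by words. A program
  names its registers and arrays explicitly and hence uses only finitely many of them; a constant
  number of arrays can be interleaved in one random-access memory with constant overhead.
  Structured control flow replaces jumps.
\<close>

datatype binop = Plus | Minus | Times | Div | Mod | Less | Equal

datatype exp =
    Const nat
  | Reg nat
  | Read nat exp
  | Bin binop exp exp

datatype com =
    Skip
  | Assign nat exp
  | Write nat exp exp
  | Seq com com
  | If exp com com
  | While exp com

type_synonym state = "(nat \<Rightarrow> nat) \<times> (nat \<Rightarrow> nat \<Rightarrow> nat)"

fun apply_op :: "binop \<Rightarrow> nat \<Rightarrow> nat \<Rightarrow> nat" where
  "apply_op Plus x y = x + y"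
| "apply_op Minus x y = x - y"
| "apply_op Times x y = x * y"
| "apply_op Div x y = x div y"
| "apply_op Mod x y = x mod y"
| "apply_op Less x y = (if x < y then 1 else 0)"
| "apply_op Equal x y = (if x = y then 1 else 0)"

fun val :: "state \<Rightarrow> exp \<Rightarrow> nat" where
  "val \<sigma> (Const c) = c"
| "val \<sigma> (Reg r) = fst \<sigma> r"
| "val \<sigma> (Read a e) = snd \<sigma> a (val \<sigma> e)"
| "val \<sigma> (Bin b e1 e2) = apply_op b (val \<sigma> e1) (val \<sigma> e2)"

text \<open>Every value arising in the evaluation, including array indices, fits into \<open>w\<close> bits.\<close>

fun fits :: "nat \<Rightarrow> state \<Rightarrow> exp \<Rightarrow> bool" where
  "fits w \<sigma> (Const c) \<longleftrightarrow> c < 2 ^ w"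
| "fits w \<sigma> (Reg r) \<longleftrightarrow> fst \<sigma> r < 2 ^ w"
| "fits w \<sigma> (Read a e) \<longleftrightarrow> fits w \<sigma> e \<and> val \<sigma> (Read a e) < 2 ^ w"
| "fits w \<sigma> (Bin b e1 e2) \<longleftrightarrow>
     fits w \<sigma> e1 \<and> fits w \<sigma> e2 \<and> val \<sigma> (Bin b e1 e2) < 2 ^ w"

fun cost :: "exp \<Rightarrow> nat" where
  "cost (Const c) = 1"
| "cost (Reg r) = 1"
| "cost (Read a e) = 1 + cost e"
| "cost (Bin b e1 e2) = 1 + cost e1 + cost e2"

text \<open>
  \<open>exec w c \<sigma> T \<tau>\<close>: on a machine with \<open>w\<close>-bit words, \<open>c\<close> started in \<open>\<sigma>\<close> halts after \<open>T\<close> unit-cost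
  steps in \<open>\<tau>\<close>. There is no rule for overflow: a program exceeding the word length gets stuck.
\<close>

inductive exec :: "nat \<Rightarrow> com \<Rightarrow> state \<Rightarrow> nat \<Rightarrow> state \<Rightarrow> bool" for w :: nat where
  Skip: "exec w Skip \<sigma> 1 \<sigma>"
| Assign: "fits w \<sigma> e \<Longrightarrow>
    exec w (Assign r e) \<sigma> (1 + cost e) ((fst \<sigma>)(r := val \<sigma> e), snd \<sigma>)"
| Write: "fits w \<sigma> e1 \<Longrightarrow> fits w \<sigma> e2 \<Longrightarrow>
    exec w (Write a e1 e2) \<sigma> (1 + cost e1 + cost e2)
      (fst \<sigma>, (snd \<sigma>)(a := (snd \<sigma> a)(val \<sigma> e1 := val \<sigma> e2)))"
| Seq: "exec w c1 \<sigma> T1 \<rho> \<Longrightarrow> exec w c2 \<rho> T2 \<tau> \<Longrightarrow> exec w (Seq c1 c2) \<sigma> (T1 + T2) \<tau>"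
| IfTrue: "fits w \<sigma> e \<Longrightarrow> val \<sigma> e \<noteq> 0 \<Longrightarrow> exec w c1 \<sigma> T \<tau> \<Longrightarrow>
    exec w (If e c1 c2) \<sigma> (1 + cost e + T) \<tau>"
| IfFalse: "fits w \<sigma> e \<Longrightarrow> val \<sigma> e = 0 \<Longrightarrow> exec w c2 \<sigma> T \<tau> \<Longrightarrow>
    exec w (If e c1 c2) \<sigma> (1 + cost e + T) \<tau>"
| WhileFalse: "fits w \<sigma> e \<Longrightarrow> val \<sigma> e = 0 \<Longrightarrow> exec w (While e c) \<sigma> (1 + cost e) \<sigma>"
| WhileTrue: "fits w \<sigma> e \<Longrightarrow> val \<sigma> e \<noteq> 0 \<Longrightarrow> exec w c \<sigma> T1 \<rho> \<Longrightarrow>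
    exec w (While e c) \<rho> T2 \<tau> \<Longrightarrow> exec w (While e c) \<sigma> (1 + cost e + T1 + T2) \<tau>"

inductive_cases SkipE: "exec w Skip \<sigma> T \<tau>"
inductive_cases AssignE: "exec w (Assign r e) \<sigma> T \<tau>"
inductive_cases WriteE: "exec w (Write a e1 e2) \<sigma> T \<tau>"
inductive_cases SeqE: "exec w (Seq c1 c2) \<sigma> T \<tau>"
inductive_cases IfE: "exec w (If e c1 c2) \<sigma> T \<tau>"
inductive_cases WhileE: "exec w (While e c) \<sigma> T \<tau>"

lemma exec_deterministic:
  "exec w c \<sigma> T \<tau> \<Longrightarrow> exec w c \<sigma> T' \<tau>' \<Longrightarrow> T' = T \<and> \<tau>' = \<tau>"
proof (induction arbitrary: T' \<tau>' rule: exec.induct)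
  case (Skip \<sigma>)
  from Skip.prems show ?case by (rule SkipE) simp
next
  case (Assign \<sigma> e r)
  from Assign.prems show ?case by (rule AssignE) simp
next
  case (Write \<sigma> e1 e2 a)
  from Write.prems show ?case by (rule WriteE) simp
next
  case (Seq c1 \<sigma> T1 \<rho> c2 T2 \<tau>)
  from Seq.prems show ?case by (rule SeqE) (metis Seq.IH)
next
  case (IfTrue \<sigma> e c1 T \<tau> c2)
  from IfTrue.prems show ?case by (rule IfE) (use IfTrue.hyps(2) in \<open>auto dest!: IfTrue.IH\<close>)
next
  case (IfFalse \<sigma> e c2 T \<tau> c1)
  from IfFalse.prems show ?case by (rule IfE) (use IfFalse.hyps(2) in \<open>auto dest!: IfFalse.IH\<close>)
next
  case (WhileFalse \<sigma> e c)
  from WhileFalse.prems show ?case by (rule WhileE) (use WhileFalse.hyps(2) in auto)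
next
  case (WhileTrue \<sigma> e c T1 \<rho> T2 \<tau>)
  from WhileTrue.prems obtain T1' \<rho>' T2' where
    *: "exec w c \<sigma> T1' \<rho>'" "exec w (While e c) \<rho>' T2' \<tau>'" "T' = 1 + cost e + T1' + T2'"
    by (rule WhileE) (use WhileTrue.hyps(2) in auto)
  have "T1' = T1" "\<rho>' = \<rho>" using WhileTrue.IH(1)[OF *(1)] by simp_all
  moreover from this have "T2' = T2" "\<tau>' = \<tau>" using WhileTrue.IH(2) *(2) by simp_all
  ultimately show ?case using *(3) by simp
qed

lemma fits_mono:
  assumes "fits w \<sigma> e" and "w \<le> w'"
  shows "fits w' \<sigma> e"
proof -
  have "(2::nat) ^ w \<le> 2 ^ w'"
    using assms(2) by (simp add: power_increasing)
  then have "x < 2 ^ w'" if "x < 2 ^ w" for x :: nat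
    using that by linarith
  with assms(1) show ?thesis
    by (induction e) simp_all
qed

lemma exec_mono:
  assumes "exec w c \<sigma> T \<tau>" and "w \<le> w'"
  shows "exec w' c \<sigma> T \<tau>"
  using assms(1)
proof induction
  case Skip
  show ?case by (rule exec.Skip)
next
  case Assign
  then show ?case by (intro exec.Assign fits_mono[OF _ assms(2)])
next
  case Write
  then show ?case by (intro exec.Write fits_mono[OF _ assms(2)])
next
  case Seq
  from Seq.IH show ?case by (rule exec.Seq)
next
  case IfTrue
  from fits_mono[OF IfTrue.hyps(1) assms(2)] IfTrue.hyps(2) IfTrue.IH
  show ?case by (rule exec.IfTrue)
next
  case IfFalse
  from fits_mono[OF IfFalse.hyps(1) assms(2)] IfFalse.hyps(2) IfFalse.IH
  show ?case by (rule exec.IfFalse)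
next
  case WhileFalse
  from fits_mono[OF WhileFalse.hyps(1) assms(2)] WhileFalse.hyps(2)
  show ?case by (rule exec.WhileFalse)
next
  case WhileTrue
  from fits_mono[OF WhileTrue.hyps(1) assms(2)] WhileTrue.hyps(2) WhileTrue.IH
  show ?case by (rule exec.WhileTrue)
qed

section \<open>Input and output\<close>

text \<open>
  An edge is given by its two endpoints, in either order. An edge set is listed in arbitrary order
  and without repetition.
\<close>

definition lists_edges :: "(nat \<times> nat) list \<Rightarrow> nat set set \<Rightarrow> bool" where
  "lists_edges ps A \<longleftrightarrow>
     distinct (map (\<lambda>(u, v). {u, v}) ps) \<and> set (map (\<lambda>(u, v). {u, v}) ps) = A"

definition flatten :: "(nat \<times> nat) list \<Rightarrow> nat list" where
  "flatten ps = concat (map (\<lambda>(u, v). [u, v]) ps)"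

text \<open>
  The vertices are \<open>0, \<dots>, n - 1\<close>. The input consists of \<open>n, m, s, t, k\<close>, the edge list of the
  graph, and for each vertex \<open>v\<close> in turn the number of edges in \<open>f v\<close> followed by a list of them.
\<close>

definition encodes ::
  "nat list \<Rightarrow> nat set \<Rightarrow> nat set set \<Rightarrow> (nat \<Rightarrow> nat set set) \<Rightarrow> nat \<Rightarrow> nat \<Rightarrow> nat \<Rightarrow> bool" where
  "encodes xs V E f s t k \<longleftrightarrow>
     (\<exists>n es fs. V = {..<n} \<and> lists_edges es E \<and>
        length fs = n \<and> (\<forall>v<n. lists_edges (fs ! v) (f v)) \<and>
        xs = [n, length es, s, t, k] @ flatten es @
             concat (map (\<lambda>ps. length ps # flatten ps) fs))"

definition initial_state :: "nat list \<Rightarrow> state" where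
  "initial_state xs =
     (\<lambda>r. 0, \<lambda>a i. if a = 0 \<and> i < length xs then xs ! i else 0)"

definition answer :: "state \<Rightarrow> nat" where
  "answer \<sigma> = fst \<sigma> 0"

end

theory Submission
  imports Defs
begin

text \<open>
  Cutting out closed subwalks keeps a walk conforming, so it suffices to look for conforming walks.
  A conforming walk from \<open>s\<close> can be extended by a walk with edge set \<open>Q\<close>, \<open>|Q| < k\<close>, that is
  conforming by itself iff the set \<open>D\<close> of at most \<open>k\<mu>\<close> edges deleted by its vertices is disjoint
  from \<open>Q\<close>. As in Monien's longest path algorithm, representative sets therefore suffice: for every
  number of vertices and every end vertex keep a tree of walks, where the root is any walk and the
  child of a node for an edge \<open>e\<close> in its set \<open>D\<close> is any walk that deletes neither \<open>e\<close> nor the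
  edges chosen above. Given \<open>Q\<close>, start at the root and move to the child for some edge of
  \<open>D \<inter> Q\<close> as long as there is one; each step collects a new edge of \<open>Q\<close>, so this ends within depth
  \<open>|Q|\<close> at a walk that \<open>Q\<close> extends, provided that any walk compatible with \<open>Q\<close> exists. The trees have
  \<open>(k\<mu>)\<^sup>O\<^sup>(\<^sup>k\<^sup>)\<close> nodes, and they are filled layer by layer, trying every edge with every node of the
  previous layer.
\<close>

section \<open>Weakest preconditions with time\<close>

text \<open>For a running time linear in \<open>n + m\<close>, an edge must be tested against a
  deleted set in constant time. So every row keeps a list of its deleted edges and also a bitmap
  over all edge codes, which is empty without cost because memory starts at zero. Edges are coded
  arithmetically from their endpoints, since the deletion lists name them by endpoints in either
  order and give no position in the edge list. The edges chosen on the way to a tree node are not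
  stored: child \<open>d\<close> of a node stands for the edge in slot \<open>d\<close> of its list,
  so they are read off the ancestors. Lists have a fixed layout of \<open>k\<close> blocks of
  \<open>\<mu>'\<close> slots, one block per vertex of the walk, and an extension fills one empty
  block. Ancestors have smaller numbers than their descendants; once the loop reaches a node, the
  edges that the node has to avoid are final. Trying all pairs of a target and a source node squares
  the number of nodes, which only affects the constant in the exponent.\<close>

definition wp :: "nat \<Rightarrow> com \<Rightarrow> state \<Rightarrow> (nat \<Rightarrow> state \<Rightarrow> bool) \<Rightarrow> bool" where
  "wp w c \<sigma> Q \<longleftrightarrow> (\<exists>T \<tau>. exec w c \<sigma> T \<tau> \<and> Q T \<tau>)"

lemma wpI: "exec w c \<sigma> T \<tau> \<Longrightarrow> Q T \<tau> \<Longrightarrow> wp w c \<sigma> Q"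
  unfolding wp_def by blast

lemma wpE:
  assumes "wp w c \<sigma> Q"
  obtains T \<tau> where "exec w c \<sigma> T \<tau>" "Q T \<tau>"
  using assms unfolding wp_def by blast

lemma wp_Skip [simp]: "wp w Skip \<sigma> Q \<longleftrightarrow> Q 1 \<sigma>"
  by (rule iffI) (erule wpE, erule SkipE, simp, rule wpI, rule exec.Skip)

lemma wp_Assign [simp]:
  "wp w (Assign r e) \<sigma> Q \<longleftrightarrow>
     fits w \<sigma> e \<and> Q (1 + cost e) ((fst \<sigma>)(r := val \<sigma> e), snd \<sigma>)"
  by (rule iffI) (erule wpE, erule AssignE, simp, rule wpI, rule exec.Assign, auto)

lemma wp_Write [simp]:
  "wp w (Write a e1 e2) \<sigma> Q \<longleftrightarrow>
     fits w \<sigma> e1 \<and> fits w \<sigma> e2 \<and>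
     Q (1 + cost e1 + cost e2) (fst \<sigma>, (snd \<sigma>)(a := (snd \<sigma> a)(val \<sigma> e1 := val \<sigma> e2)))"
  by (rule iffI) (erule wpE, erule WriteE, simp, rule wpI, rule exec.Write, auto)

lemma wp_Seq [simp]:
  "wp w (Seq c1 c2) \<sigma> Q \<longleftrightarrow> wp w c1 \<sigma> (\<lambda>T1 \<rho>. wp w c2 \<rho> (\<lambda>T2. Q (T1 + T2)))"
  unfolding wp_def by (blast intro: exec.Seq elim: SeqE)

lemma wp_If [simp]:
  "wp w (If e c1 c2) \<sigma> Q \<longleftrightarrow>
     fits w \<sigma> e \<and> (val \<sigma> e \<noteq> 0 \<longrightarrow> wp w c1 \<sigma> (\<lambda>T. Q (1 + cost e + T))) \<and>
     (val \<sigma> e = 0 \<longrightarrow> wp w c2 \<sigma> (\<lambda>T. Q (1 + cost e + T)))"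
  (is "?L \<longleftrightarrow> ?R")
proof
  assume ?L
  then show ?R by (elim wpE IfE) (auto intro: wpI)
next
  assume R: ?R
  show ?L
  proof (cases "val \<sigma> e = 0")
    case True
    with R have "fits w \<sigma> e" "wp w c2 \<sigma> (\<lambda>T. Q (1 + cost e + T))" by auto
    with True show ?thesis by (auto elim!: wpE intro: wpI[OF exec.IfFalse])
  next
    case False
    with R have "fits w \<sigma> e" "wp w c1 \<sigma> (\<lambda>T. Q (1 + cost e + T))" by auto
    with False show ?thesis by (auto elim!: wpE intro: wpI[OF exec.IfTrue])
  qed
qed

lemma wp_mono: "wp w c \<sigma> Q \<Longrightarrow> (\<And>T \<tau>. Q T \<tau> \<Longrightarrow> Q' T \<tau>) \<Longrightarrow> wp w c \<sigma> Q'"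
  unfolding wp_def by blast

text \<open>The index \<open>j\<close> is a measure that every round decreases, so there are at most
  \<open>j\<close> rounds of cost at most \<open>B\<close> each; the summand 1 in
  \<open>j + 1\<close> pays for the final failing test.\<close>

lemma wp_While:
  assumes "I j \<sigma>"
    and fits: "\<And>j \<sigma>. I j \<sigma> \<Longrightarrow> fits w \<sigma> e"
    and body: "\<And>j \<sigma>. I j \<sigma> \<Longrightarrow> val \<sigma> e \<noteq> 0 \<Longrightarrow> wp w c \<sigma> (\<lambda>T \<tau>. T \<le> B \<and> (\<exists>j'<j. I j' \<tau>))"
    and post: "\<And>j' \<tau> T. I j' \<tau> \<Longrightarrow> val \<tau> e = 0 \<Longrightarrow> T \<le> (j + 1) * (1 + cost e + B) \<Longrightarrow> Q T \<tau>"
  shows "wp w (While e c) \<sigma> Q"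
proof -
  have "\<exists>T \<tau> j'. exec w (While e c) \<sigma> T \<tau> \<and> I j' \<tau> \<and> val \<tau> e = 0 \<and>
      T \<le> (j + 1) * (1 + cost e + B)"
    using assms(1)
  proof (induction j arbitrary: \<sigma> rule: less_induct)
    case (less j)
    show ?case
    proof (cases "val \<sigma> e = 0")
      case True
      have "1 + cost e \<le> (j + 1) * (1 + cost e + B)" by simp
      with exec.WhileFalse[OF fits[OF less.prems] True] True less.prems show ?thesis by blast
    next
      case False
      from body[OF less.prems this] obtain T1 \<rho> j' where
        1: "exec w c \<sigma> T1 \<rho>" "T1 \<le> B" "j' < j" "I j' \<rho>"
        unfolding wp_def by blast
      from less.IH[OF 1(3,4)] obtain T2 \<tau> j'' where
        2: "exec w (While e c) \<rho> T2 \<tau>" "I j'' \<tau>" "val \<tau> e = 0"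
          "T2 \<le> (j' + 1) * (1 + cost e + B)" by blast
      have "T2 \<le> j * (1 + cost e + B)"
        by (rule order.trans[OF 2(4)], rule mult_right_mono) (use 1(3) in auto)
      then have "1 + cost e + T1 + T2 \<le> (j + 1) * (1 + cost e + B)"
        using 1(2) by simp
      with exec.WhileTrue[OF fits[OF less.prems] False 1(1) 2(1)] 2(2,3) show ?thesis by blast
    qed
  qed
  with post show ?thesis unfolding wp_def by blast
qed

text \<open>A counting loop with measure \<open>N - j\<close>. The 4 is one step plus the three
  nodes of the comparison, and \<open>1 < w\<close> lets the result 1 of the comparison fit into a
  word. The invariant has to guarantee the content of the limit register, since the body could
  overwrite it.\<close>

lemma wp_For:
  assumes start: "fst \<sigma> r = a" "a \<le> N" "I a \<sigma>"
    and fits: "\<And>j \<sigma>. a \<le> j \<Longrightarrow> j \<le> N \<Longrightarrow> I j \<sigma> \<Longrightarrow> fst \<sigma> r = j \<Longrightarrow> fst \<sigma> r' = N \<and> N < 2 ^ w"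
    and body: "\<And>j \<sigma>. a \<le> j \<Longrightarrow> j < N \<Longrightarrow> I j \<sigma> \<Longrightarrow> fst \<sigma> r = j \<Longrightarrow>
      wp w c \<sigma> (\<lambda>T \<tau>. T \<le> B \<and> fst \<tau> r = Suc j \<and> I (Suc j) \<tau>)"
    and small: "1 < w"
    and post: "\<And>\<tau> T. I N \<tau> \<Longrightarrow> fst \<tau> r = N \<Longrightarrow> T \<le> (N - a + 1) * (4 + B) \<Longrightarrow> Q T \<tau>"
  shows "wp w (While (Bin Less (Reg r) (Reg r')) c) \<sigma> Q"
proof -
  have w1: "(1::nat) < 2 ^ w" using small by (intro one_less_power) simp_all
  define J where "J = (\<lambda>i \<sigma>. \<exists>j. i = N - j \<and> a \<le> j \<and> j \<le> N \<and> fst \<sigma> r = j \<and> I j \<sigma>)"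
  show ?thesis
  proof (rule wp_While[where I = J and B = B and j = "N - a"])
    show "J (N - a) \<sigma>" using start by (auto simp: J_def)
  next
    fix j \<sigma>
    assume "J j \<sigma>"
    then obtain i where i: "a \<le> i" "i \<le> N" "fst \<sigma> r = i" "I i \<sigma>" "j = N - i"
      by (auto simp: J_def)
    note 1 = fits[OF i(1,2,4,3)]
    then have "i < 2 ^ w" using i(2) by linarith
    then show "fits w \<sigma> (Bin Less (Reg r) (Reg r'))" using 1 i(3) w1 by simp
    assume "val \<sigma> (Bin Less (Reg r) (Reg r')) \<noteq> 0"
    then have "i < N" using 1 i(3) by (simp split: if_splits)
    show "wp w c \<sigma> (\<lambda>T \<tau>. T \<le> B \<and> (\<exists>j'<j. J j' \<tau>))"
    proof (rule wp_mono[OF body[OF i(1) \<open>i < N\<close> i(4,3)]])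
      fix T \<tau> assume "T \<le> B \<and> fst \<tau> r = Suc i \<and> I (Suc i) \<tau>"
      then have "T \<le> B \<and> N - Suc i < j \<and> J (N - Suc i) \<tau>"
        using i \<open>i < N\<close> by (auto simp: J_def)
      then show "T \<le> B \<and> (\<exists>j'<j. J j' \<tau>)" by blast
    qed
  next
    fix j' \<tau> T
    assume J: "J j' \<tau>" and v: "val \<tau> (Bin Less (Reg r) (Reg r')) = 0"
      and T: "T \<le> (N - a + 1) * (1 + cost (Bin Less (Reg r) (Reg r')) + B)"
    from J obtain i where i: "a \<le> i" "i \<le> N" "fst \<tau> r = i" "I i \<tau>"
      by (auto simp: J_def)
    then have "i = N" using fits[OF i(1,2,4,3)] v by (simp split: if_splits)
    moreover have "1 + cost (Bin Less (Reg r) (Reg r')) = 4" by simp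
    ultimately show "Q T \<tau>" using i T by (metis post)
  qed
qed

section \<open>Conforming walks\<close>

text \<open>Repeated vertices are allowed, so that appending a vertex is a condition on the new edge
  alone and no visited vertices have to be remembered.\<close>

definition conforming_walk ::
  "'a set set \<Rightarrow> ('a \<Rightarrow> 'a set set) \<Rightarrow> 'a \<Rightarrow> 'a list \<Rightarrow> bool" where
  "conforming_walk E f s p \<longleftrightarrow>
     p \<noteq> [] \<and> hd p = s \<and> conforming f p \<and> (\<forall>i. Suc i < length p \<longrightarrow> {p ! i, p ! Suc i} \<in> E)"

lemma conforming_walk_single [simp]: "conforming_walk E f s [s]"
  by (simp add: conforming_walk_def conforming_def)

text \<open>The appended vertex comes too late to delete the edge that leads to it, hence only the
  vertices of \<open>p\<close> are asked.\<close>

lemma conforming_walk_snoc: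
  assumes "p \<noteq> []"
  shows "conforming_walk E f s (p @ [v]) \<longleftrightarrow>
    conforming_walk E f s p \<and> {last p, v} \<in> E \<and> (\<forall>x\<in>set p. {last p, v} \<notin> f x)"
proof -
  have l: "last p = p ! (length p - 1)" using assms by (rule last_conv_nth)
  have 1: "(\<forall>i. Suc i < length (p @ [v]) \<longrightarrow> {(p @ [v]) ! i, (p @ [v]) ! Suc i} \<in> E) \<longleftrightarrow>
    (\<forall>i. Suc i < length p \<longrightarrow> {p ! i, p ! Suc i} \<in> E) \<and> {last p, v} \<in> E" (is "?L \<longleftrightarrow> ?R")
  proof
    assume L: ?L
    have "{p ! i, p ! Suc i} \<in> E" if "Suc i < length p" for i
      using L[rule_format, of i] that by (simp add: nth_append)
    moreover have "{last p, v} \<in> E"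
      using L[rule_format, of "length p - 1"] assms by (simp add: nth_append l)
    ultimately show ?R by blast
  next
    assume ?R
    moreover have "i = length p - 1" if "Suc i < length (p @ [v])" "\<not> Suc i < length p" for i
      using that by simp
    ultimately show ?L
      using assms by (auto simp: nth_append l)
  qed
  have 2: "conforming f (p @ [v]) \<longleftrightarrow> conforming f p \<and> (\<forall>x\<in>set p. {last p, v} \<notin> f x)"
    (is "?L \<longleftrightarrow> ?R")
  proof
    assume L: ?L
    have "{p ! i, p ! Suc i} \<notin> f (p ! j)" if "Suc i < length p" "j \<le> i" for i j
      using L[unfolded conforming_def, rule_format, of i j] that by (simp add: nth_append)
    moreover have "{last p, v} \<notin> f (p ! j)" if "j < length p" for j
      using L[unfolded conforming_def, rule_format, of "length p - 1" j] that assms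
      by (simp add: nth_append l)
    ultimately show ?R by (auto simp: conforming_def in_set_conv_nth)
  next
    assume R: ?R
    show ?L unfolding conforming_def
    proof (intro allI impI)
      fix i j
      assume a: "Suc i < length (p @ [v]) \<and> j \<le> i"
      show "{(p @ [v]) ! i, (p @ [v]) ! Suc i} \<notin> f ((p @ [v]) ! j)"
      proof (cases "Suc i < length p")
        case True
        then show ?thesis using R a by (simp add: nth_append conforming_def)
      next
        case False
        then have "i = length p - 1" using a by auto
        then have "j < length p" using a assms by (cases p) auto
        with R have "{last p, v} \<notin> f (p ! j)" by simp
        with \<open>i = length p - 1\<close> \<open>j < length p\<close> assms show ?thesis by (simp add: nth_append l)
      qed
    qed
  qed
  show ?thesis unfolding conforming_walk_def 1 2 using assms by auto
qed

text \<open>Cutting out a closed subwalk removes deletions and keeps the order of the rest.\<close>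

lemma conforming_walk_shortcut:
  assumes "conforming_walk E f s p" and "last p = t" and "\<not> distinct p"
  shows "\<exists>q. conforming_walk E f s q \<and> last q = t \<and> length q < length p"
proof -
  from assms(3) obtain as bs cs y where p: "p = as @ [y] @ bs @ [y] @ cs"
    using not_distinct_decomp by blast
  define q where "q = as @ [y] @ cs"
  \<comment> \<open>\<open>h i\<close> is the position in \<open>p\<close> of the
    \<open>i\<close>-th vertex of \<open>q\<close>; the copy of \<open>y\<close> that stays is the
    first one.\<close>
  define h where "h i = (if i < length as + 1 then i else i + length bs + 1)" for i
  have len: "length q < length p" unfolding p q_def by simp
  have h: "q ! i = p ! h i" "h i < length p" if "i < length q" for i
  proof -
    have "cs ! (i - Suc (length as)) = cs ! (i + length bs + 1 - (length as + length bs + 2))"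
      by simp
    then show "q ! i = p ! h i" "h i < length p"
      using that unfolding p q_def h_def
      by (auto simp: nth_append nth_Cons Suc_diff_le split: nat.splits)
  qed
  \<comment> \<open>The edge leaving \<open>y\<close> in \<open>q\<close> leaves the second copy of
    \<open>y\<close> in \<open>p\<close>, behind position \<open>h i\<close>. Edges are therefore
    matched with positions \<open>i'\<close> that are only bounded below by \<open>h i\<close>,
    which is all that \<open>conforming\<close> needs.\<close>
  have step: "p ! Suc (h i) = q ! Suc i \<and> Suc (h i) < length p \<or>
      (\<exists>i'. p ! i' = q ! i \<and> p ! Suc i' = q ! Suc i \<and> Suc i' < length p \<and> h i \<le> i')"
    if "Suc i < length q" for i
  proof (cases "i = length as")
    case True
    have "p ! (length as + length bs + 1) = q ! i \<and> p ! Suc (length as + length bs + 1) = q ! Suc i \<and>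
        Suc (length as + length bs + 1) < length p \<and> h i \<le> length as + length bs + 1"
      using True that unfolding p q_def h_def by (simp add: nth_append nth_Cons)
    then show ?thesis by blast
  next
    case False
    then have "Suc (h i) = h (Suc i)" unfolding h_def by auto
    then show ?thesis using h[OF that] by simp
  qed
  have key: "\<exists>i'. p ! i' = q ! i \<and> p ! Suc i' = q ! Suc i \<and> Suc i' < length p \<and> h i \<le> i'"
    if "Suc i < length q" for i
    using step[OF that] h[of i] that by force
  have "{q ! i, q ! Suc i} \<in> E" if "Suc i < length q" for i
    using key[OF that] assms(1) unfolding conforming_walk_def by metis
  moreover have "conforming f q" unfolding conforming_def
  proof (intro allI impI)
    fix i j assume a: "Suc i < length q \<and> j \<le> i"
    from key[of i] a obtain i' where
      i': "p ! i' = q ! i" "p ! Suc i' = q ! Suc i" "Suc i' < length p" "h i \<le> i'" by blast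
    have "h j \<le> h i" using a unfolding h_def by auto
    then have "{p ! i', p ! Suc i'} \<notin> f (p ! h j)"
      using i' assms(1) unfolding conforming_walk_def conforming_def by (meson order.trans)
    then show "{q ! i, q ! Suc i} \<notin> f (q ! j)" using i' h(1)[of j] a by simp
  qed
  moreover have "q \<noteq> []" "hd q = s" "last q = t"
    using assms(1,2) unfolding conforming_walk_def p q_def
    by (cases as; simp; cases cs; simp)+
  ultimately show ?thesis using len unfolding conforming_walk_def by blast
qed

lemma conforming_path_of_walk:
  assumes "conforming_walk E f s p" and "last p = t"
  shows "\<exists>q. conforming_walk E f s q \<and> last q = t \<and> distinct q \<and> length q \<le> length p"
  using assms
proof (induction "length p" arbitrary: p rule: less_induct)
  case less
  show ?case
  proof (cases "distinct p")
    case True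
    with less.prems show ?thesis by blast
  next
    case False
    from conforming_walk_shortcut[OF less.prems this] obtain q where
      q: "conforming_walk E f s q" "last q = t" "length q < length p" by blast
    from less.hyps[OF q(3,1,2)] q(3) show ?thesis by (metis less_imp_le order.trans)
  qed
qed

lemma conforming_walk_subset:
  assumes "conforming_walk E f s p" and "simple_graph V E" and "s \<in> V"
  shows "set p \<subseteq> V"
proof
  fix x assume "x \<in> set p"
  then obtain i where i: "i < length p" "x = p ! i" by (metis in_set_conv_nth)
  show "x \<in> V"
  proof (cases i)
    case 0
    then show ?thesis using i assms by (simp add: conforming_walk_def hd_conv_nth)
  next
    case (Suc j)
    then have "{p ! j, p ! i} \<in> E" using i assms(1) by (simp add: conforming_walk_def)
    then show ?thesis using assms(2) i(2) unfolding simple_graph_def by blast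
  qed
qed

text \<open>Shortcuts never lengthen a walk, so the bound \<open>k\<close> survives the passage to a
  path.\<close>

lemma has_short_conforming_path_iff_walk:
  assumes "simple_graph V E" and "s \<in> V"
  shows "has_short_conforming_path V E f s t k \<longleftrightarrow>
    (\<exists>p. conforming_walk E f s p \<and> last p = t \<and> length p \<le> k)"
proof
  assume "has_short_conforming_path V E f s t k"
  then show "\<exists>p. conforming_walk E f s p \<and> last p = t \<and> length p \<le> k"
    unfolding has_short_conforming_path_def is_path_def conforming_walk_def by blast
next
  assume "\<exists>p. conforming_walk E f s p \<and> last p = t \<and> length p \<le> k"
  then obtain p where p: "conforming_walk E f s p" "last p = t" "length p \<le> k" by blast
  from conforming_path_of_walk[OF p(1,2)] obtain q where
    "conforming_walk E f s q" "last q = t" "distinct q" "length q \<le> k"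
    using p(3) order.trans by blast
  then show "has_short_conforming_path V E f s t k"
    using conforming_walk_subset[OF _ assms] 
    unfolding has_short_conforming_path_def is_path_def conforming_walk_def by blast
qed

section \<open>Representative tables\<close>

text \<open>
  The endpoints of an edge are recovered from their sum and their product, which is below \<open>n * n\<close>;
  code \<open>0\<close> is reserved for absent entries.
\<close>

definition edge_code :: "nat \<Rightarrow> nat \<Rightarrow> nat \<Rightarrow> nat" where
  "edge_code n a b = (a + b) * (n * n) + a * b + 1"

lemma row_index_inj:
  fixes a b c d N :: nat
  assumes "a * N + b = c * N + d" and "b < N" and "d < N"
  shows "a = c \<and> b = d"
proof -
  have "(a * N + b) div N = a" "(c * N + d) div N = c" using assms(2,3) by simp_all
  then have "a = c" using assms(1) by simp
  then show ?thesis using assms(1) by simp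
qed

lemma row_index_less:
  fixes a b M N :: nat
  assumes "a < M" and "b < N"
  shows "a * N + b < M * N"
proof -
  have "a * N + b < Suc a * N" using assms(2) by simp
  also have "\<dots> \<le> M * N" using assms(1) by (intro mult_right_mono) simp_all
  finally show ?thesis .
qed

lemma edge_code_pos [simp]: "0 < edge_code n a b"
  by (simp add: edge_code_def)

lemma edge_code_less:
  assumes "a < n" and "b < n"
  shows "edge_code n a b < 2 * n * n * n + 1"
proof -
  have "a * b < n * n" using assms by (intro mult_strict_mono) auto
  moreover have "a + b < 2 * n" using assms by simp
  ultimately have "(a + b) * (n * n) + a * b < 2 * n * (n * n)" by (rule row_index_less[rotated])
  then show ?thesis by (simp add: edge_code_def mult.assoc)
qed

lemma edge_code_commute: "edge_code n a b = edge_code n b a"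
  by (simp add: edge_code_def add.commute mult.commute)

lemma edge_code_inject:
  assumes "a < n" "b < n" "c < n" "d < n"
  shows "edge_code n a b = edge_code n c d \<longleftrightarrow> {a, b} = {c, d}"
proof
  assume eq: "edge_code n a b = edge_code n c d"
  have "a * b < n * n" "c * d < n * n" using assms by (auto intro!: mult_strict_mono)
  with eq have sp: "a + b = c + d" "a * b = c * d"
    using row_index_inj[of "a + b" "n * n" "a * b" "c + d" "c * d"]
    by (auto simp: edge_code_def)
  \<comment> \<open>The quadratic \<open>(x - c) * (x - d)\<close> is evaluated at \<open>a\<close>,
    over the integers so that subtraction is genuine. Since it has the same coefficients as
    \<open>(x - a) * (x - b)\<close>, it vanishes there.\<close>
  have "(int a - int c) * (int a - int d) = int a * int a - int a * int (c + d) + int (c * d)"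
    by (simp add: algebra_simps)
  also have "\<dots> = 0" unfolding sp[symmetric] by (simp add: algebra_simps)
  finally have "a = c \<or> a = d" by simp
  then show "{a, b} = {c, d}" using sp(1) by auto
next
  assume "{a, b} = {c, d}"
  then have "a = c \<and> b = d \<or> a = d \<and> b = c" by (auto simp: doubleton_eq_iff)
  then show "edge_code n a b = edge_code n c d" using edge_code_commute by auto
qed

text \<open>
  The \<open>p\<close>-ary tree on the natural numbers: child \<open>d < p\<close> of node \<open>x\<close> is \<open>x * p + d + 1\<close>.
  \<open>branches p x\<close> lists the pairs (node, child number) on the way from the root to \<open>x\<close>.
\<close>

fun branches :: "nat \<Rightarrow> nat \<Rightarrow> (nat \<times> nat) set" where
  "branches p 0 = {}"
| "branches p (Suc x) = insert (x div p, x mod p) (branches p (x div p))"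

text \<open>Parents have smaller numbers than their children. Everything read along a branch thus
  belongs to nodes that the main loop has already passed.\<close>

lemma branches_bounds:
  assumes "(x, d) \<in> branches p c" and "0 < p"
  shows "x < c \<and> d < p"
  using assms
proof (induction p c rule: branches.induct)
  case (2 p c)
  have "c div p \<le> c" by (rule div_le_dividend)
  moreover have "x \<le> c div p \<and> d < p" using 2 by (auto simp: less_imp_le)
  ultimately show ?case by linarith
qed simp

lemma branches_child:
  assumes "d < p"
  shows "branches p (c * p + d + 1) = insert (c, d) (branches p c)"
  using assms by simp

section \<open>Instances, table layout and the invariant of the tables\<close>

locale instance_data =
  fixes n :: nat and es :: "(nat \<times> nat) list" and fs :: "(nat \<times> nat) list list"
    and E :: "nat set set" and f :: "nat \<Rightarrow> nat set set" and s t k :: nat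
  assumes sdg: "self_deleting_graph {..<n} E f"
    and s: "s < n" and t: "t < n" and k: "k \<ge> 1"
    and es: "lists_edges es E"
    and length_fs: "length fs = n" and fs: "\<And>v. v < n \<Longrightarrow> lists_edges (fs ! v) (f v)"
begin

definition "m = length es"
text \<open>The successor keeps the block length positive, as it is used as a divisor, and makes
  every deletion list strictly shorter than a block.\<close>

definition "\<mu>' = Suc (max_deletions {..<n} f)"
text \<open>One block of \<open>\<mu>'\<close> slots for each of up to \<open>k\<close> vertices of
  a walk. This is also the arity of the trees, as every slot may have a child.\<close>

definition "p = k * \<mu>'"
text \<open>In the numbering of \<open>branches\<close>, a node \<open>c\<close> at depth
  \<open>j\<close> satisfies \<open>c + 1 \<le> (p + 1) ^ j\<close>, and the search stays below
  depth \<open>k\<close>.\<close>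

definition "P = (p + 1) ^ k"
definition "R = 2 * n * n * n + 1"
text \<open>Number of loop positions per layer: \<open>P\<close> target nodes, \<open>2 * m\<close>
  oriented edges, \<open>P\<close> source nodes. Layer 0 holds just the row of \<open>s\<close>, so
  the loop runs from \<open>z\<^sub>0\<close> to \<open>k * z\<^sub>0\<close>.\<close>

definition "z\<^sub>0 = P * (2 * m) * P"

lemma n_pos: "0 < n" using s by simp
lemma \<mu>'_pos: "0 < \<mu>'" by (simp add: \<mu>'_def)
lemma p_pos: "0 < p" using k by (simp add: p_def \<mu>'_pos)
lemma P_pos: "0 < P" by (simp add: P_def)
lemma R_pos: "0 < R" by (simp add: R_def)

lemma graph: "simple_graph {..<n} E"
  using sdg by (simp add: self_deleting_graph_def)

lemma edge_bounds: "{a, b} \<in> E \<Longrightarrow> a < n \<and> b < n"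
  using graph unfolding simple_graph_def by auto

lemma f_subset: "v < n \<Longrightarrow> f v \<subseteq> E"
  using sdg unfolding self_deleting_graph_def by auto

lemma length_fs_nth: "v < n \<Longrightarrow> length (fs ! v) = card (f v)"
  using fs[of v] unfolding lists_edges_def by (metis distinct_card length_map)

lemma length_fs_less: "v < n \<Longrightarrow> length (fs ! v) < \<mu>'"
proof -
  assume v: "v < n"
  have "length (fs ! v) = card (f v)" using v by (rule length_fs_nth)
  also have "\<dots> \<le> max_deletions {..<n} f"
    unfolding max_deletions_def using v by (intro Max_ge) auto
  finally show ?thesis by (simp add: \<mu>'_def)
qed

text \<open>Slots past the end of the list read 0, the code of no edge; this pads all lists to the
  uniform length \<open>\<mu>'\<close>.\<close>

definition del_code :: "nat \<Rightarrow> nat \<Rightarrow> nat" where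
  "del_code v l = (if l < length (fs ! v)
     then edge_code n (fst (fs ! v ! l)) (snd (fs ! v ! l)) else 0)"

definition del_codes :: "nat \<Rightarrow> nat set" where
  "del_codes v = {edge_code n a b | a b. {a, b} \<in> f v}"

lemma fs_nth: "v < n \<Longrightarrow> l < length (fs ! v) \<Longrightarrow> {fst (fs ! v ! l), snd (fs ! v ! l)} \<in> f v"
proof -
  assume a: "v < n" "l < length (fs ! v)"
  have "(\<lambda>(u, v). {u, v}) (fs ! v ! l) \<in> f v"
    using fs[OF a(1)] nth_mem[OF a(2)] unfolding lists_edges_def by auto
  then show ?thesis by (simp add: case_prod_beta)
qed

lemma fs_nth_bounds:
  "v < n \<Longrightarrow> l < length (fs ! v) \<Longrightarrow> fst (fs ! v ! l) < n \<and> snd (fs ! v ! l) < n"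
  using fs_nth f_subset edge_bounds by blast

lemma del_code_less: "v < n \<Longrightarrow> del_code v l < R"
  using edge_code_less fs_nth_bounds by (simp add: del_code_def R_def)

lemma del_codes_eq: "v < n \<Longrightarrow> del_codes v = {y. y \<noteq> 0 \<and> (\<exists>l<\<mu>'. del_code v l = y)}"
proof (intro set_eqI iffI)
  fix y assume v: "v < n" and "y \<in> del_codes v"
  then obtain a b where ab: "y = edge_code n a b" "{a, b} \<in> f v" by (auto simp: del_codes_def)
  then have "{a, b} \<in> (\<lambda>(u, v). {u, v}) ` set (fs ! v)"
    using fs[OF v] by (simp add: lists_edges_def)
  then obtain l where l: "l < length (fs ! v)" "{a, b} = {fst (fs ! v ! l), snd (fs ! v ! l)}"
    by (auto simp: in_set_conv_nth)
  have "a < n" "b < n" using ab(2) f_subset[OF v] edge_bounds by blast+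
  then have "del_code v l = y"
    using l ab(1) edge_code_inject fs_nth_bounds[OF v l(1)] by (simp add: del_code_def)
  then show "y \<in> {y. y \<noteq> 0 \<and> (\<exists>l<\<mu>'. del_code v l = y)}"
    using length_fs_less[OF v] l(1) ab(1) by (auto intro!: exI[of _ l])
next
  fix y assume v: "v < n" and "y \<in> {y. y \<noteq> 0 \<and> (\<exists>l<\<mu>'. del_code v l = y)}"
  then show "y \<in> del_codes v"
    using fs_nth[OF v] by (auto simp: del_codes_def del_code_def split: if_splits)
qed

lemma edge_code_in_del_codes:
  assumes "v < n" "a < n" "b < n"
  shows "edge_code n a b \<in> del_codes v \<longleftrightarrow> {a, b} \<in> f v"
proof
  assume "edge_code n a b \<in> del_codes v"
  then obtain c d where cd: "edge_code n a b = edge_code n c d" "{c, d} \<in> f v"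
    by (auto simp: del_codes_def)
  then have "c < n" "d < n" using f_subset[OF assms(1)] edge_bounds by blast+
  then show "{a, b} \<in> f v" using cd edge_code_inject assms(2,3) by metis
qed (auto simp: del_codes_def)

text \<open>
  Row \<open>r = (i * P + c) * n + v\<close> of the tables belongs to layer \<open>i\<close>, tree node \<open>c\<close> and vertex \<open>v\<close>.
  \<open>D r \<noteq> 0\<close> says that the row holds a conforming walk from \<open>s\<close> to \<open>v\<close> with \<open>i + 1\<close> vertices;
  \<open>L (r * p + d)\<close> for \<open>d < p\<close> enumerates the codes of the edges deleted by it, and
  \<open>M (r * R + y)\<close> tells whether \<open>y\<close> is such a code.
\<close>

definition deleted :: "(nat \<Rightarrow> nat) \<Rightarrow> nat \<Rightarrow> nat set" where
  "deleted L r = {y. y \<noteq> 0 \<and> (\<exists>d<p. L (r * p + d) = y)}"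

text \<open>The edges chosen between the root and the node of row \<open>r\<close>: a branch
  \<open>(x, d)\<close> stands for the edge in slot \<open>d\<close> of ancestor \<open>x\<close>,
  in the same layer and at the same vertex. An empty slot contributes 0, which marks a node that
  must not be filled.\<close>

definition avoided :: "(nat \<Rightarrow> nat) \<Rightarrow> nat \<Rightarrow> nat set" where
  "avoided L r =
     (\<lambda>(x, d). L (((r div n div P * P + x) * n + r mod n) * p + d)) ` branches p (r div n mod P)"

text \<open>The third conjunct keeps the blocks of later vertices empty, so that an extension
  overwrites nothing. Bit 0 of the bitmap is left open because copying an empty slot sets it. The
  last conjunct says that the row fits its tree node: all ancestor slots on the branch are occupied
  and the walk deletes none of their edges.\<close>

definition good_row :: "(nat \<Rightarrow> nat) \<Rightarrow> (nat \<Rightarrow> nat) \<Rightarrow> nat \<Rightarrow> bool" where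
  "good_row L M r \<longleftrightarrow>
     r < k * P * n \<and>
     (\<exists>q. conforming_walk E f s q \<and> last q = r mod n \<and> length q = Suc (r div n div P) \<and>
        deleted L r = \<Union> (del_codes ` set q)) \<and>
     (\<forall>d<p. r div n div P < d div \<mu>' \<longrightarrow> L (r * p + d) = 0) \<and>
     (\<forall>y. 0 < y \<longrightarrow> y < R \<longrightarrow> (M (r * R + y) \<noteq> 0 \<longleftrightarrow> y \<in> deleted L r)) \<and>
     (\<forall>y\<in>avoided L r. y \<noteq> 0 \<and> y \<notin> deleted L r)"

text \<open>Entry \<open>j\<close> of the flattened edge list. Number \<open>j\<close> stands for
  the edge oriented away from this entry; the other end is entry
  \<open>j + 1 - 2 * (j mod 2)\<close>, which is \<open>j\<close> with its last bit flipped.\<close>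

definition endpoint :: "nat \<Rightarrow> nat" where
  "endpoint j = (if even j then fst (es ! (j div 2)) else snd (es ! (j div 2)))"

text \<open>Position \<open>z\<close> of the main loop encodes a target phase, an oriented edge and a source node.\<close>

definition "phase z = z div P div (2 * m)"
definition "tail z = endpoint (z div P mod (2 * m))"
definition "head z = endpoint (z div P mod (2 * m) + 1 - 2 * (z div P mod (2 * m) mod 2))"
definition "target z = phase z * n + head z"
definition "source z = ((phase z div P - 1) * P + z mod P) * n + tail z"

text \<open>Whether the target is still free is left out on purpose: the predicate then depends only
  on rows of earlier nodes, and the last clause of \<open>table_inv\<close> can be maintained for
  positions already passed.\<close>

definition admissible :: "(nat \<Rightarrow> nat) \<Rightarrow> (nat \<Rightarrow> nat) \<Rightarrow> (nat \<Rightarrow> nat) \<Rightarrow> nat \<Rightarrow> bool" where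
  "admissible D L M z \<longleftrightarrow>
     D (source z) \<noteq> 0 \<and> M (source z * R + edge_code n (tail z) (head z)) = 0 \<and>
     (\<forall>y\<in>avoided L (target z). y \<noteq> 0 \<and> M (source z * R + y) = 0 \<and> y \<notin> del_codes (head z))"

text \<open>Block \<open>i\<close> belongs to vertex number \<open>i\<close> of the walk, counted
  from 0, and receives the deletions of \<open>v\<close>; the other blocks are copied.\<close>

definition new_entry :: "(nat \<Rightarrow> nat) \<Rightarrow> nat \<Rightarrow> nat \<Rightarrow> nat \<Rightarrow> nat \<Rightarrow> nat" where
  "new_entry L i v src d = (if d div \<mu>' = i then del_code v (d mod \<mu>') else L (src * p + d))"

text \<open>\<open>N\<close> is the number of slots already written: intermediate values serve the
  loop that writes a row, and \<open>N = p\<close> is the finished row.\<close>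

definition new_L :: "(nat \<Rightarrow> nat) \<Rightarrow> nat \<Rightarrow> nat \<Rightarrow> nat \<Rightarrow> nat \<Rightarrow> nat \<Rightarrow> nat \<Rightarrow> nat" where
  "new_L L i v src tgt N q =
     (if \<exists>d<N. q = tgt * p + d then new_entry L i v src (q - tgt * p) else L q)"

definition new_M ::
  "(nat \<Rightarrow> nat) \<Rightarrow> (nat \<Rightarrow> nat) \<Rightarrow> nat \<Rightarrow> nat \<Rightarrow> nat \<Rightarrow> nat \<Rightarrow> nat \<Rightarrow> nat \<Rightarrow> nat" where
  "new_M L M i v src tgt N q =
     (if \<exists>d<N. q = tgt * R + new_entry L i v src d then 1 else M q)"

text \<open>The last clause records progress: wherever a position already passed offers a valid
  extension, the target is occupied, by this extension or by another one. Empty rows have to be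
  blank because rows are written without being cleared.\<close>

definition table_inv ::
  "(nat \<Rightarrow> nat) \<Rightarrow> (nat \<Rightarrow> nat) \<Rightarrow> (nat \<Rightarrow> nat) \<Rightarrow> nat \<Rightarrow> bool" where
  "table_inv D L M z \<longleftrightarrow>
     (\<forall>q. D q \<le> 1 \<and> L q < R \<and> M q \<le> 1) \<and> D s \<noteq> 0 \<and>
     (\<forall>r. D r \<noteq> 0 \<longrightarrow> good_row L M r) \<and>
     (\<forall>r. D r = 0 \<longrightarrow> (\<forall>d<p. L (r * p + d) = 0) \<and> (\<forall>y<R. M (r * R + y) = 0)) \<and>
     (\<forall>z'. z\<^sub>0 \<le> z' \<and> z' < z \<and> admissible D L M z' \<longrightarrow> D (target z') \<noteq> 0)"

lemma new_entry_less: "v < n \<Longrightarrow> (\<And>q. L q < R) \<Longrightarrow> new_entry L i v src d < R"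
  by (simp add: new_entry_def del_code_less)

section \<open>Effect of writing one row\<close>

lemma new_L_row:
  assumes "d < p"
  shows "new_L L i v src tgt p (r * p + d) =
    (if r = tgt then new_entry L i v src d else L (r * p + d))"
proof -
  have "(\<exists>d'<p. r * p + d = tgt * p + d') \<longleftrightarrow> r = tgt"
    using row_index_inj assms by blast
  then show ?thesis by (simp add: new_L_def)
qed

lemma new_M_row:
  assumes "y < R" and "v < n" and "\<And>q. L q < R"
  shows "new_M L M i v src tgt p (r * R + y) =
    (if r = tgt \<and> (\<exists>d<p. new_entry L i v src d = y) then 1 else M (r * R + y))"
proof -
  have "r * R + y = tgt * R + new_entry L i v src d \<longleftrightarrow> r = tgt \<and> new_entry L i v src d = y" for d
    using row_index_inj[OF _ assms(1) new_entry_less[OF assms(2), of L, OF assms(3)]] by blast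
  then show ?thesis by (auto simp: new_M_def)
qed

text \<open>Block \<open>i\<close> of the source is empty, so putting the deletions of
  \<open>v\<close> in its place loses no edge deleted by the source walk.\<close>

lemma deleted_new:
  assumes "i < k" and "v < n"
    and src: "\<And>d. d < p \<Longrightarrow> d div \<mu>' = i \<Longrightarrow> L (src * p + d) = 0"
  shows "deleted (new_L L i v src tgt p) r =
    (if r = tgt then deleted L src \<union> del_codes v else deleted L r)"
proof (cases "r = tgt")
  case True
  have "deleted (new_L L i v src tgt p) tgt = {y. y \<noteq> 0 \<and> (\<exists>d<p. new_entry L i v src d = y)}"
    by (auto simp: deleted_def new_L_row)
  also have "\<dots> = deleted L src \<union> del_codes v"
  proof (intro set_eqI iffI)
    fix y assume "y \<in> {y. y \<noteq> 0 \<and> (\<exists>d<p. new_entry L i v src d = y)}"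
    then obtain d where "y \<noteq> 0" "d < p" "new_entry L i v src d = y" by blast
    moreover have "d mod \<mu>' < \<mu>'" using \<mu>'_pos by simp
    ultimately show "y \<in> deleted L src \<union> del_codes v"
      by (auto simp: new_entry_def deleted_def del_codes_eq[OF assms(2)] split: if_splits)
  next
    fix y assume "y \<in> deleted L src \<union> del_codes v"
    then consider d where "y \<noteq> 0" "d < p" "L (src * p + d) = y"
      | l where "y \<noteq> 0" "l < \<mu>'" "del_code v l = y"
      by (auto simp: deleted_def del_codes_eq[OF assms(2)])
    then show "y \<in> {y. y \<noteq> 0 \<and> (\<exists>d<p. new_entry L i v src d = y)}"
    proof cases
      case 1
      then have "d div \<mu>' \<noteq> i" using src by auto
      then show ?thesis using 1 by (auto simp: new_entry_def)
    next
      case 2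
      have "i * \<mu>' + l < p" unfolding p_def using assms(1) 2(2) by (rule row_index_less)
      moreover have "new_entry L i v src (i * \<mu>' + l) = y" using 2 by (simp add: new_entry_def)
      ultimately show ?thesis using 2(1) by blast
    qed
  qed
  finally show ?thesis using True by simp
qed (auto simp: deleted_def new_L_row)

lemma avoided_cong:
  assumes "\<And>x d. (x, d) \<in> branches p (r div n mod P) \<Longrightarrow> d < p \<Longrightarrow> x < r div n mod P \<Longrightarrow>
    L' (((r div n div P * P + x) * n + r mod n) * p + d) =
    L (((r div n div P * P + x) * n + r mod n) * p + d)"
  shows "avoided L' r = avoided L r"
  unfolding avoided_def
  by (rule image_cong) (use assms branches_bounds p_pos in \<open>auto\<close>)

text \<open>Only proper ancestors are read, and these have smaller numbers; a row up to the phase of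
  the target therefore never reads the target.\<close>

lemma avoided_new:
  assumes "r div n \<le> tgt div n"
  shows "avoided (new_L L i v src tgt p) r = avoided L r"
proof (rule avoided_cong)
  fix x d
  assume "d < p" "x < r div n mod P"
  define r' where "r' = (r div n div P * P + x) * n + r mod n"
  have "r' div n = r div n div P * P + x"
    using n_pos unfolding r'_def by simp
  also have "\<dots> < r div n"
    using \<open>x < r div n mod P\<close> by (metis add_less_cancel_left div_mult_mod_eq)
  finally have "r' \<noteq> tgt" using assms by auto
  then show "new_L L i v src tgt p (((r div n div P * P + x) * n + r mod n) * p + d) =
      L (((r div n div P * P + x) * n + r mod n) * p + d)"
    using \<open>d < p\<close> unfolding r'_def[symmetric] by (simp add: new_L_row)
qed

text \<open>The counterpart for rows of arbitrary phase: if all avoided codes are nonzero, none of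
  them was read from the target, whose row was blank.\<close>

lemma avoided_new':
  assumes "\<forall>y\<in>avoided L r. y \<noteq> 0" and "\<forall>d<p. L (tgt * p + d) = 0"
  shows "avoided (new_L L i v src tgt p) r = avoided L r"
proof (rule avoided_cong)
  fix x d
  assume b: "(x, d) \<in> branches p (r div n mod P)" and d: "d < p"
  define r' where "r' = (r div n div P * P + x) * n + r mod n"
  have "L (r' * p + d) \<noteq> 0"
    using assms(1) b unfolding avoided_def r'_def by force
  then have "r' \<noteq> tgt" using assms(2) d by auto
  then show "new_L L i v src tgt p (((r div n div P * P + x) * n + r mod n) * p + d) =
      L (((r div n div P * P + x) * n + r mod n) * p + d)"
    using d unfolding r'_def[symmetric] by (simp add: new_L_row)
qed

section \<open>Positions of the main loop\<close>

lemma phase_mono: "z \<le> z' \<Longrightarrow> phase z \<le> phase z'"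
  unfolding phase_def by (intro div_le_mono)

lemma endpoint_edge:
  assumes "j < 2 * m"
  shows "{endpoint j, endpoint (j + 1 - 2 * (j mod 2))} \<in> E"
proof -
  define h where "h = j div 2"
  have h: "h < length es" using assms by (simp add: h_def m_def)
  have E: "{fst (es ! h), snd (es ! h)} \<in> E"
    using es nth_mem[OF h] by (auto simp: lists_edges_def case_prod_beta)
  show ?thesis
  proof (cases "even j")
    case True
    then have "j = 2 * h" by (simp add: h_def)
    then show ?thesis using E by (simp add: endpoint_def)
  next
    case False
    then have "j = 2 * h + 1" by (simp add: h_def)
    then show ?thesis using E by (simp add: endpoint_def insert_commute)
  qed
qed

lemma endpoint_edge_exists:
  assumes "{u, v} \<in> E"
  shows "\<exists>j<2 * m. endpoint j = u \<and> endpoint (j + 1 - 2 * (j mod 2)) = v"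
proof -
  from assms es obtain h where h: "h < length es" "{u, v} = {fst (es ! h), snd (es ! h)}"
    by (auto simp: lists_edges_def in_set_conv_nth)
  then consider "u = fst (es ! h)" "v = snd (es ! h)" | "u = snd (es ! h)" "v = fst (es ! h)"
    by (auto simp: doubleton_eq_iff)
  then show ?thesis
  proof cases
    case 1
    then show ?thesis using h(1) by (intro exI[of _ "2 * h"]) (simp add: endpoint_def m_def)
  next
    case 2
    then show ?thesis using h(1) by (intro exI[of _ "2 * h + 1"]) (simp add: endpoint_def m_def)
  qed
qed

context
  fixes z
  assumes z: "z\<^sub>0 \<le> z" "z < k * z\<^sub>0"
begin

lemma m_pos: "0 < m" using z by (cases m) (auto simp: z\<^sub>0_def)

lemma phase_bounds: "P \<le> phase z" "phase z < k * P"
proof -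
  have "P * (2 * m) \<le> z div P" using z(1) P_pos by (simp add: z\<^sub>0_def less_eq_div_iff_mult_less_eq)
  then show "P \<le> phase z" using m_pos by (simp add: phase_def less_eq_div_iff_mult_less_eq)
  have "z div P < k * P * (2 * m)"
    using z(2) P_pos by (intro less_mult_imp_div_less) (simp add: z\<^sub>0_def ac_simps)
  then show "phase z < k * P" unfolding phase_def by (rule less_mult_imp_div_less)
qed

lemma edge_z: "{tail z, head z} \<in> E"
  unfolding tail_def head_def using m_pos by (intro endpoint_edge) simp

lemma tail_less: "tail z < n" and head_less: "head z < n"
  using edge_z edge_bounds by blast+

lemma layer_bounds: "0 < phase z div P" "phase z div P < k"
  using phase_bounds P_pos by (simp_all add: div_greater_zero_iff less_mult_imp_div_less)

lemma target_props: "target z div n = phase z" "target z mod n = head z" "target z < k * P * n"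
  unfolding target_def using head_less phase_bounds(2) row_index_less[OF phase_bounds(2) head_less]
  by simp_all

lemma source_props: "source z div n div P = phase z div P - 1" "source z mod n = tail z"
  "source z < k * P * n" "source z div n < phase z"
proof -
  have 1: "source z div n = (phase z div P - 1) * P + z mod P"
    unfolding source_def using tail_less by simp
  show "source z div n div P = phase z div P - 1" unfolding 1 using P_pos by simp
  show "source z mod n = tail z" unfolding source_def using tail_less by simp
  have "(phase z div P - 1) * P + z mod P < phase z div P * P"
    using layer_bounds P_pos by (intro row_index_less) simp_all
  also have "\<dots> \<le> phase z" by simp
  finally have 2: "(phase z div P - 1) * P + z mod P < phase z" .
  with 1 show "source z div n < phase z" by simp
  show "source z < k * P * n"
    unfolding source_def using row_index_less[OF less_trans[OF 2 phase_bounds(2)] tail_less] .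
qed

end

section \<open>Preservation of the table invariant\<close>

lemma table_inv_skip:
  assumes "table_inv D L M z" and "\<not> (admissible D L M z \<and> D (target z) = 0)"
  shows "table_inv D L M (Suc z)"
  using assms unfolding table_inv_def by (metis less_Suc_eq)

text \<open>An occupied row could be disturbed only through the ancestor slots it reads, and an
  earlier position only through its source or the ancestors of its target; the row written now is
  none of these.\<close>

lemma table_inv_new:
  assumes z: "z\<^sub>0 \<le> z" "z < k * z\<^sub>0" and inv: "table_inv D L M z"
    and adm: "admissible D L M z" and free: "D (target z) = 0"
  defines "i \<equiv> phase z div P"
  shows "table_inv (D(target z := 1)) (new_L L i (head z) (source z) (target z) p)
    (new_M L M i (head z) (source z) (target z) p) (Suc z)"
proof -
  let ?D = "D(target z := 1)"
  let ?L = "new_L L i (head z) (source z) (target z) p"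
  let ?M = "new_M L M i (head z) (source z) (target z) p"
  note tp = target_props[OF z] and sp = source_props[OF z]
  have ik: "0 < i" "i < k" using layer_bounds[OF z] by (simp_all add: i_def)
  have hd: "head z < n" and tl: "tail z < n" using head_less[OF z] tail_less[OF z] .
  have bounds: "D q \<le> 1" "L q < R" "M q \<le> 1" for q using inv by (simp_all add: table_inv_def)
  have undef: "L (r * p + d) = 0" if "D r = 0" "d < p" for r d
    using inv that by (simp add: table_inv_def)
  have undefM: "M (r * R + y) = 0" if "D r = 0" "y < R" for r y
    using inv that by (simp add: table_inv_def)
  have rows: "good_row L M r" if "D r \<noteq> 0" for r using inv that by (simp add: table_inv_def)
  have src: "good_row L M (source z)" using adm rows by (simp add: admissible_def)
  have src0: "L (source z * p + d) = 0" if "d < p" "i \<le> d div \<mu>'" for d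
    using src that sp(1) ik by (auto simp: good_row_def i_def)
  have del: "deleted ?L r =
      (if r = target z then deleted L (source z) \<union> del_codes (head z) else deleted L r)" for r
    using src0 by (intro deleted_new[OF ik(2) hd]) auto
  have Lrow: "?L (r * p + d) =
      (if r = target z then new_entry L i (head z) (source z) d else L (r * p + d))"
    if "d < p" for r d using that by (rule new_L_row)
  have Mrow: "?M (r * R + y) = (if r = target z \<and>
      (\<exists>d<p. new_entry L i (head z) (source z) d = y) then 1 else M (r * R + y))"
    if "y < R" for r y using new_M_row[OF that hd bounds(2)] .
  have av: "avoided ?L r = avoided L r" if "r div n \<le> phase z" for r
    using avoided_new that tp(1) by simp
  \<comment> \<open>Nothing relates the phase of \<open>r\<close> to the current one here; that the
    avoided codes of a good row are nonzero takes the place of such a bound.\<close>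
  have old: "good_row ?L ?M r" if "D r \<noteq> 0" for r
  proof -
    have r: "r \<noteq> target z" using that free by auto
    note g = rows[OF that]
    have "avoided ?L r = avoided L r"
      using g undef[OF free] by (intro avoided_new') (auto simp: good_row_def)
    with g r show ?thesis by (simp add: good_row_def del Lrow Mrow)
  qed
  have new: "good_row ?L ?M (target z)"
  proof -
    from src obtain q where q: "conforming_walk E f s q" "last q = tail z"
        "length q = i" "deleted L (source z) = \<Union> (del_codes ` set q)"
      using sp(1,2) ik(1) by (auto simp: good_row_def i_def)
    have qn: "q \<noteq> []" using q(1) by (simp add: conforming_walk_def)
    have qV: "set q \<subseteq> {..<n}" using conforming_walk_subset[OF q(1) graph] s by simp
    have ecR: "edge_code n (tail z) (head z) < R"
      using edge_code_less[OF tl hd] by (simp add: R_def)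
    \<comment> \<open>The code is positive and below \<open>R\<close>, the range in which the bitmap
      is exact; so a zero bit means that no vertex of the walk deletes the edge.\<close>
    have "edge_code n (tail z) (head z) \<notin> deleted L (source z)"
    proof -
      have "M (source z * R + edge_code n (tail z) (head z)) = 0"
        using adm by (simp add: admissible_def)
      moreover have "\<forall>y. 0 < y \<longrightarrow> y < R \<longrightarrow> (M (source z * R + y) \<noteq> 0 \<longleftrightarrow> y \<in> deleted L (source z))"
        using src by (simp add: good_row_def)
      ultimately show ?thesis using ecR edge_code_pos by metis
    qed
    then have "{tail z, head z} \<notin> f x" if "x \<in> set q" for x
      using q(4) that edge_code_in_del_codes[of x, OF _ tl hd] qV by auto
    then have w: "conforming_walk E f s (q @ [head z])"
      using q(1,2) edge_z[OF z] by (simp add: conforming_walk_snoc[OF qn])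
    have d: "deleted ?L (target z) = \<Union> (del_codes ` set (q @ [head z]))"
      unfolding del using q(4) by auto
    have 1: "\<exists>q. conforming_walk E f s q \<and> last q = target z mod n \<and>
        length q = Suc (target z div n div P) \<and> deleted ?L (target z) = \<Union> (del_codes ` set q)"
      using w q(3) d tp(1,2) unfolding i_def by (intro exI[of _ "q @ [head z]"]) simp
    have 2: "?L (target z * p + d) = 0" if "d < p" "target z div n div P < d div \<mu>'" for d
      using that src0[of d] tp(1) unfolding Lrow[OF that(1)] by (simp add: new_entry_def i_def)
    have 3: "?M (target z * R + y) \<noteq> 0 \<longleftrightarrow> y \<in> deleted ?L (target z)" if "0 < y" "y < R" for y
    proof -
      have "?M (target z * R + y) \<noteq> 0 \<longleftrightarrow> (\<exists>d<p. new_entry L i (head z) (source z) d = y)"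
        using Mrow[OF that(2)] undefM[OF free that(2)] by simp
      also have "\<dots> \<longleftrightarrow> y \<in> deleted ?L (target z)"
        using that(1) by (auto simp: deleted_def Lrow)
      finally show ?thesis .
    qed
    have 4: "y \<noteq> 0 \<and> y \<notin> deleted ?L (target z)" if "y \<in> avoided ?L (target z)" for y
    proof -
      have y: "y \<in> avoided L (target z)" using that av tp(1) by simp
      have "y < R" using y bounds(2) unfolding avoided_def by auto
      have 0: "y \<noteq> 0" "M (source z * R + y) = 0" "y \<notin> del_codes (head z)"
        using adm y by (auto simp: admissible_def)
      moreover have "M (source z * R + y) \<noteq> 0 \<longleftrightarrow> y \<in> deleted L (source z)"
        using src \<open>y < R\<close> 0(1) by (simp add: good_row_def)
      ultimately show ?thesis by (simp add: del)
    qed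
    show ?thesis unfolding good_row_def using tp(3) 1 2 3 4 by blast
  qed
  \<comment> \<open>The current target has just been filled. For an earlier position, admissibility
    in the new tables is pulled back to the old ones, where the invariant applies.\<close>
  have comp: "?D (target z') \<noteq> 0"
    if z': "z\<^sub>0 \<le> z'" "z' < Suc z" and adm': "admissible ?D ?L ?M z'" for z'
  proof (cases "z' = z")
    case False
    then have "z' < z" using z'(2) by simp
    then have z'k: "z' < k * z\<^sub>0" using z(2) by simp
    have ph: "phase z' \<le> phase z" using phase_mono \<open>z' < z\<close> by simp
    have ne: "source z' \<noteq> target z"
      using source_props(4)[OF z'(1) z'k] ph tp(1) by auto
    have ec: "edge_code n (tail z') (head z') < R"
      using edge_code_less tail_less[OF z'(1) z'k] head_less[OF z'(1) z'k] by (simp add: R_def)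
    have av': "avoided ?L (target z') = avoided L (target z')"
      using av target_props(1)[OF z'(1) z'k] ph by simp
    have "y < R" if "y \<in> avoided L (target z')" for y
      using that bounds(2) unfolding avoided_def by auto
    then have "admissible D L M z'"
      using adm' ne unfolding admissible_def av' by (simp add: Mrow ec)
    then show ?thesis using inv z' \<open>z' < z\<close> by (auto simp: table_inv_def)
  qed simp
  show ?thesis unfolding table_inv_def
  proof (intro conjI allI impI)
    fix q
    show "?D q \<le> 1" "?M q \<le> 1" using bounds by (simp_all add: new_M_def)
    show "?L q < R" using bounds new_entry_less[OF hd] by (simp add: new_L_def)
  next
    show "?D s \<noteq> 0" using inv by (simp add: table_inv_def)
  next
    fix r assume "?D r \<noteq> 0"
    then show "good_row ?L ?M r" using old new by (cases "r = target z") auto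
  next
    fix r d assume "?D r = 0" "d < p"
    then show "?L (r * p + d) = 0" using undef by (auto simp: Lrow split: if_splits)
  next
    fix r y assume "?D r = 0" "y < R"
    then show "?M (r * R + y) = 0" using undefM by (auto simp: Mrow split: if_splits)
  qed (use comp in blast)
qed

text \<open>The first row is treated as an extension on blank tables with \<open>s\<close> as both
  source and target. It is node 0 of layer 0, a root, so it has nothing to avoid.\<close>

lemma table_inv_init:
  "table_inv ((\<lambda>_. 0)(s := 1)) (new_L (\<lambda>_. 0) 0 s s s p) (new_M (\<lambda>_. 0) (\<lambda>_. 0) 0 s s s p) z\<^sub>0"
proof -
  let ?L = "new_L (\<lambda>_. 0) 0 s s s p"
  let ?M = "new_M (\<lambda>_. 0) (\<lambda>_. 0) 0 s s s p"
  have sn: "s div n = 0" "s mod n = s" using s by simp_all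
  have del: "deleted ?L s = del_codes s"
    using deleted_new[of 0 s "\<lambda>_. 0" s s s] k s by (auto simp: deleted_def[of "\<lambda>_. 0"])
  have Lrow: "?L (r * p + d) = (if r = s then new_entry (\<lambda>_. 0) 0 s s d else 0)"
    if "d < p" for r d using new_L_row[OF that] by simp
  have Mrow: "?M (r * R + y) =
      (if r = s \<and> (\<exists>d<p. new_entry (\<lambda>_. 0) 0 s s d = y) then 1 else 0)"
    if "y < R" for r y using new_M_row[OF that s, of "\<lambda>_. 0"] R_pos by simp
  have "s < k * P * n"
  proof -
    have "0 * n + s < k * P * n" using k P_pos s by (intro row_index_less) simp_all
    then show ?thesis by simp
  qed
  moreover have "\<exists>q. conforming_walk E f s q \<and> last q = s \<and> length q = Suc 0 \<and>
      deleted ?L s = \<Union> (del_codes ` set q)"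
    by (intro exI[of _ "[s]"]) (simp add: del)
  moreover have "?L (s * p + d) = 0" if "d < p" "0 < d div \<mu>'" for d
    using that by (simp add: Lrow new_entry_def)
  moreover have "?M (s * R + y) \<noteq> 0 \<longleftrightarrow> y \<in> deleted ?L s" if "0 < y" "y < R" for y
    using that by (auto simp: Mrow deleted_def Lrow)
  ultimately have "good_row ?L ?M s"
    unfolding good_row_def avoided_def using sn by simp
  moreover have "?L q < R" for q
    using new_entry_less[OF s, of "\<lambda>_. 0"] R_pos by (simp add: new_L_def)
  ultimately show ?thesis
    unfolding table_inv_def by (simp add: Lrow Mrow) (simp add: new_M_def)
qed

text \<open>The representative property, proved for every finite set \<open>Q\<close> of nonzero
  codes instead of only edge sets of walks. Stepping back by one vertex adds the last edge to
  \<open>Q\<close>, and \<open>card Q + i < k\<close> keeps its size below \<open>k\<close>, the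
  depth for which the trees have room.\<close>

lemma table_complete:
  assumes inv: "table_inv D L M (k * z\<^sub>0)"
    and "i < k" and "conforming_walk E f s q" and "length q = Suc i" and "last q = v"
    and "finite Q" and "card Q + i < k" and "0 \<notin> Q" and "\<Union> (del_codes ` set q) \<inter> Q = {}"
  shows "\<exists>c<P. D ((i * P + c) * n + v) \<noteq> 0 \<and> deleted L ((i * P + c) * n + v) \<inter> Q = {}"
  using assms(2-)
proof (induction i arbitrary: q v Q)
  case 0
  then have "q = [s]" by (cases q) (auto simp: conforming_walk_def)
  have Ds: "D s \<noteq> 0" using inv by (simp add: table_inv_def)
  then have "good_row L M s" using inv by (simp add: table_inv_def)
  then obtain q' where q': "conforming_walk E f s q'" "length q' = Suc 0"
      "deleted L s = \<Union> (del_codes ` set q')"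
    using s by (auto simp: good_row_def)
  from q'(1,2) have "q' = [s]" by (cases q') (auto simp: conforming_walk_def)
  then show ?case using Ds q'(3) 0 \<open>q = [s]\<close> P_pos by (intro exI[of _ 0]) simp
next
  case (Suc i)
  define q' where "q' = butlast q"
  have q: "q = q' @ [v]" "length q' = Suc i" "q' \<noteq> []"
    using Suc.prems(3,4) unfolding q'_def by (cases q rule: rev_cases; force)+
  define u where "u = last q'"
  have w: "conforming_walk E f s q'" "{u, v} \<in> E" "\<forall>x\<in>set q'. {u, v} \<notin> f x"
    using Suc.prems(2) conforming_walk_snoc[OF q(3)] unfolding q(1) u_def by blast+
  have uv: "u < n" "v < n" using edge_bounds w(2) by blast+
  have q'V: "set q' \<subseteq> {..<n}" using conforming_walk_subset[OF w(1) graph] s by simp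
  \<comment> \<open>The edge \<open>{u, v}\<close> joins \<open>Q\<close>: the source row supplied
    by the induction hypothesis must not delete the edge over which it is to be extended.\<close>
  let ?Q = "insert (edge_code n u v) Q"
  have "edge_code n u v \<notin> del_codes x" if "x \<in> set q'" for x
    using that q'V w(3) edge_code_in_del_codes[OF _ uv, of x] by auto
  then have "\<Union> (del_codes ` set q') \<inter> ?Q = {}"
    using Suc.prems(8) unfolding q(1) by auto
  moreover have "card ?Q + i < k" using card_insert_le_m1[of "Suc (card Q)" Q] Suc.prems(5,6)
    by (simp add: card_insert_if)
  ultimately obtain c' where c': "c' < P" "D ((i * P + c') * n + u) \<noteq> 0"
      "deleted L ((i * P + c') * n + u) \<inter> ?Q = {}"
    using Suc.IH[OF _ w(1) q(2) u_def[symmetric], of ?Q] Suc.prems(1,5,7) by auto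
  let ?src = "(i * P + c') * n + u"
  have src: "good_row L M ?src" using inv c'(2) by (simp add: table_inv_def)
  have bounds: "L q < R" for q using inv by (simp add: table_inv_def)
  have M0: "M (?src * R + y) = 0" if "y \<in> ?Q" "y < R" for y
  proof -
    have "y \<noteq> 0" "y \<notin> deleted L ?src" using that c'(3) Suc.prems(7) by auto
    then show ?thesis using src that(2) by (auto simp: good_row_def)
  qed
  obtain j where j: "j < 2 * m" "endpoint j = u" "endpoint (j + 1 - 2 * (j mod 2)) = v"
    using endpoint_edge_exists[OF w(2)] by blast
  \<comment> \<open>The same source row and the same edge serve every node \<open>c\<close> whose
    avoided edges lie in \<open>Q\<close>, because neither the source walk nor \<open>v\<close>
    deletes anything in \<open>Q\<close>. Hence all nodes met on the descent are occupied.\<close>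
  have fill: "D ((Suc i * P + c) * n + v) \<noteq> 0"
    if c: "c < P" and X: "avoided L ((Suc i * P + c) * n + v) \<subseteq> Q" for c
  proof -
    define z where "z = ((Suc i * P + c) * (2 * m) + j) * P + c'"
    have zP: "z div P = (Suc i * P + c) * (2 * m) + j" "z mod P = c'"
      using c'(1) unfolding z_def by simp_all
    have j': "z div P mod (2 * m) = j" "phase z = Suc i * P + c"
      using j(1) unfolding phase_def zP by simp_all
    have "tail z = u" "head z = v" using j unfolding tail_def head_def j' by simp_all
    moreover have "phase z div P = Suc i" unfolding j' using c by (simp del: mult_Suc)
    ultimately have ts: "target z = (Suc i * P + c) * n + v" "source z = ?src"
      unfolding target_def source_def zP(2) j'(2)[symmetric] by simp_all
    have "Suc i * P + c < k * P" using Suc.prems(1) c by (rule row_index_less)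
    then have "z < k * P * (2 * m) * P"
      unfolding z_def using row_index_less[OF row_index_less[OF _ j(1)] c'(1)] by blast
    then have zk: "z < k * z\<^sub>0" by (simp add: z\<^sub>0_def ac_simps)
    have "z\<^sub>0 \<le> z" unfolding z_def z\<^sub>0_def by (simp add: algebra_simps)
    have ec: "edge_code n u v < R" using edge_code_less[OF uv] by (simp add: R_def)
    have "y \<noteq> 0 \<and> M (?src * R + y) = 0 \<and> y \<notin> del_codes v" if "y \<in> avoided L (target z)" for y
    proof -
      have yQ: "y \<in> Q" using X that ts by auto
      have "y < R" using that bounds unfolding avoided_def by auto
      then have "M (?src * R + y) = 0" using yQ by (intro M0) simp_all
      moreover have "y \<noteq> 0" using yQ Suc.prems(7) by metis
      moreover have "y \<notin> del_codes v" using yQ Suc.prems(8) unfolding q(1) by auto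
      ultimately show ?thesis by blast
    qed
    then have "admissible D L M z"
      unfolding admissible_def ts(2) \<open>tail z = u\<close> \<open>head z = v\<close> using c'(2) M0 ec by simp
    then show ?thesis using inv zk \<open>z\<^sub>0 \<le> z\<close> ts(1) unfolding table_inv_def by metis
  qed
  \<comment> \<open>The descent. Its first assumption bounds the number of a node by its depth,
    measured as the number of distinct avoided edges, and so keeps the next node below
    \<open>P\<close>.\<close>
  have "\<exists>c<P. D ((Suc i * P + c) * n + v) \<noteq> 0 \<and> deleted L ((Suc i * P + c) * n + v) \<inter> Q = {}"
    if "c + 1 \<le> (p + 1) ^ card (avoided L ((Suc i * P + c) * n + v))" and "c < P"
      and "avoided L ((Suc i * P + c) * n + v) \<subseteq> Q" for c
    using that
  proof (induction "card Q - card (avoided L ((Suc i * P + c) * n + v))" arbitrary: c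
      rule: less_induct)
    case less
    let ?r = "(Suc i * P + c) * n + v"
    have "D ?r \<noteq> 0" using fill less.prems(2,3) .
    then have row: "good_row L M ?r" using inv by (simp add: table_inv_def)
    have r: "?r mod n = v" "?r div n = Suc i * P + c" using uv by simp_all
    have rc: "?r div n div P = Suc i" "?r div n mod P = c" unfolding r using less.prems(2) by (simp_all del: mult_Suc)
    show ?case
    proof (cases "deleted L ?r \<inter> Q = {}")
      case True
      then show ?thesis using \<open>D ?r \<noteq> 0\<close> less.prems(2) by blast
    next
      case False
      then obtain y where y: "y \<in> deleted L ?r" "y \<in> Q" by blast
      then obtain d where d: "d < p" "L (?r * p + d) = y" by (auto simp: deleted_def)
      \<comment> \<open>A good row deletes none of the edges it avoids, so \<open>y\<close> is new
        and the child avoids exactly one edge more.\<close>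
      have yn: "y \<notin> avoided L ?r" using row y(1) by (auto simp: good_row_def)
      define c1 where "c1 = c * p + d + 1"
      let ?r1 = "(Suc i * P + c1) * n + v"
      have fin: "finite (avoided L ?r)" using less.prems(3) Suc.prems(5) finite_subset by blast
      have "insert y (avoided L ?r) \<subseteq> Q" using y(2) less.prems(3) by simp
      then have cardQ: "Suc (card (avoided L ?r)) \<le> card Q"
        using card_mono[OF Suc.prems(5)] yn fin by (metis card_insert_disjoint)
      have "c1 + 1 \<le> (c + 1) * (p + 1)" unfolding c1_def using d(1) by simp
      also have "\<dots> \<le> (p + 1) ^ card (avoided L ?r) * (p + 1)"
        using less.prems(1) by (intro mult_right_mono) simp_all
      finally have c1: "c1 + 1 \<le> (p + 1) ^ Suc (card (avoided L ?r))" by (simp add: ac_simps)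
      also have "\<dots> \<le> P"
      proof -
        have "Suc (card (avoided L ?r)) \<le> k" using cardQ Suc.prems(6) by linarith
        then show ?thesis unfolding P_def by (rule power_increasing) simp
      qed
      finally have c1P: "c1 < P" by simp
      have r1: "?r1 mod n = v" "?r1 div n = Suc i * P + c1" using uv by simp_all
      have r1c: "?r1 div n div P = Suc i" "?r1 div n mod P = c1" unfolding r1 using c1P by (simp_all del: mult_Suc)
      have "avoided L ?r1 = insert y (avoided L ?r)"
        unfolding avoided_def r1(1) r1c r(1) rc unfolding c1_def branches_child[OF d(1)]
        using d(2) by simp
      moreover from this have "card (avoided L ?r1) = Suc (card (avoided L ?r))"
        using yn fin by simp
      ultimately show ?thesis
        using less.hyps[of c1] c1 c1P cardQ y(2) less.prems(3) by simp
    qed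
  qed
  from this[of 0] show ?case using P_pos uv by (simp add: avoided_def)
qed

text \<open>Rows of all layers below \<open>k\<close> count, which turns exactly
  \<open>i + 1\<close> vertices into at most \<open>k\<close>. Completeness is applied with
  \<open>Q\<close> empty: no further extension has to be possible at \<open>t\<close>.\<close>

lemma table_correct:
  assumes inv: "table_inv D L M (k * z\<^sub>0)"
  shows "(\<exists>r. D r \<noteq> 0 \<and> r mod n = t) \<longleftrightarrow> has_short_conforming_path {..<n} E f s t k"
proof -
  have s': "s \<in> {..<n}" using s by simp
  show ?thesis unfolding has_short_conforming_path_iff_walk[OF graph s']
  proof
    assume "\<exists>r. D r \<noteq> 0 \<and> r mod n = t"
    then obtain r where r: "D r \<noteq> 0" "r mod n = t" by blast
    then have "good_row L M r" using inv by (simp add: table_inv_def)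
    then obtain q where q: "conforming_walk E f s q" "last q = t" "length q = Suc (r div n div P)"
        and "r < k * P * n" using r(2) by (auto simp: good_row_def)
    then have "r div n div P < k" by (simp add: less_mult_imp_div_less)
    then show "\<exists>q. conforming_walk E f s q \<and> last q = t \<and> length q \<le> k"
      using q by (intro exI[of _ q]) simp
  next
    assume "\<exists>q. conforming_walk E f s q \<and> last q = t \<and> length q \<le> k"
    then obtain q where q: "conforming_walk E f s q" "last q = t" "length q \<le> k" by blast
    then have "q \<noteq> []" by (simp add: conforming_walk_def)
    then obtain i where i: "length q = Suc i" "i < k" using q(3) by (cases q) auto
    from table_complete[OF inv i(2) q(1) i(1) q(2), of "{}"] i(2)
    obtain c where "D ((i * P + c) * n + t) \<noteq> 0" by auto
    then show "\<exists>r. D r \<noteq> 0 \<and> r mod n = t" using t by (intro exI[of _ "(i * P + c) * n + t"]) simp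
  qed
qed

end

section \<open>The program\<close>

abbreviation bin_plus (infixl "[+]" 65) where "bin_plus \<equiv> Bin Plus"
abbreviation bin_minus (infixl "[-]" 65) where "bin_minus \<equiv> Bin Minus"
abbreviation bin_times (infixl "[*]" 70) where "bin_times \<equiv> Bin Times"
abbreviation bin_div (infixl "[div]" 70) where "bin_div \<equiv> Bin Div"
abbreviation bin_mod (infixl "[mod]" 70) where "bin_mod \<equiv> Bin Mod"
abbreviation bin_less (infix "[<]" 55) where "bin_less \<equiv> Bin Less"
abbreviation bin_eq (infix "[=]" 55) where "bin_eq \<equiv> Bin Equal"
notation Seq (infixr ";;" 51)

abbreviation (input) "ans \<equiv> 0 :: nat"
abbreviation (input) "rn \<equiv> 2 :: nat"
abbreviation (input) "rm \<equiv> 3 :: nat"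
abbreviation (input) "rs \<equiv> 4 :: nat"
abbreviation (input) "rt \<equiv> 5 :: nat"
abbreviation (input) "rk \<equiv> 6 :: nat"
abbreviation (input) "r\<mu> \<equiv> 7 :: nat"
abbreviation (input) "rp \<equiv> 8 :: nat"
abbreviation (input) "rP \<equiv> 9 :: nat"
abbreviation (input) "rnn \<equiv> 10 :: nat"
abbreviation (input) "rR \<equiv> 11 :: nat"
abbreviation (input) "rz \<equiv> 12 :: nat"
abbreviation (input) "rlim \<equiv> 13 :: nat"
abbreviation (input) "ri \<equiv> 14 :: nat"
abbreviation (input) "rph \<equiv> 15 :: nat"
abbreviation (input) "ru \<equiv> 16 :: nat"
abbreviation (input) "rv \<equiv> 17 :: nat"
abbreviation (input) "rsrc \<equiv> 18 :: nat"
abbreviation (input) "rtgt \<equiv> 19 :: nat"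
abbreviation (input) "rx \<equiv> 20 :: nat"
abbreviation (input) "rok \<equiv> 21 :: nat"
abbreviation (input) "rd \<equiv> 22 :: nat"
abbreviation (input) "ry \<equiv> 23 :: nat"
abbreviation (input) "rpos \<equiv> 24 :: nat"
abbreviation (input) "rl \<equiv> 25 :: nat"
abbreviation (input) "rmm \<equiv> 26 :: nat"
abbreviation (input) "rq \<equiv> 27 :: nat"
abbreviation (input) "aIn \<equiv> 0 :: nat"
abbreviation (input) "aOff \<equiv> 2 :: nat"
abbreviation (input) "aFL \<equiv> 3 :: nat"
abbreviation (input) "aF \<equiv> 4 :: nat"
abbreviation (input) "aD \<equiv> 5 :: nat"
abbreviation (input) "aL \<equiv> 6 :: nat"
abbreviation (input) "aM \<equiv> 7 :: nat"

abbreviation "edge_code_exp x y \<equiv> (Reg x [+] Reg y) [*] Reg rnn [+] Reg x [*] Reg y [+] Const 1"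

definition read_header :: com where
  "read_header =
     Assign rn (Read aIn (Const 0));; Assign rm (Read aIn (Const 1));;
     Assign rs (Read aIn (Const 2));; Assign rt (Read aIn (Const 3));;
     Assign rk (Read aIn (Const 4))"

definition scan_body :: com where
  "scan_body =
     Write aOff (Reg rv) (Reg rpos);;
     Assign ry (Read aIn (Reg rpos));;
     If (Reg r\<mu> [<] Reg ry) (Assign r\<mu> (Reg ry)) Skip;;
     Assign rpos (Reg rpos [+] Const 1 [+] Const 2 [*] Reg ry);;
     Assign rv (Reg rv [+] Const 1)"

definition scan :: com where
  "scan =
     Assign rpos (Const 5 [+] Const 2 [*] Reg rm);;
     Assign rv (Const 0);; Assign r\<mu> (Const 0);;
     While (Reg rv [<] Reg rn) scan_body"

definition parameters :: com where
  "parameters =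
     Assign r\<mu> (Reg r\<mu> [+] Const 1);; Assign rp (Reg rk [*] Reg r\<mu>);;
     Assign rP (Const 1);; Assign rd (Const 0);;
     While (Reg rd [<] Reg rk)
       (Assign rP (Reg rP [*] (Reg rp [+] Const 1));; Assign rd (Reg rd [+] Const 1));;
     Assign rnn (Reg rn [*] Reg rn);;
     Assign rR (Const 2 [*] Reg rn [*] Reg rn [*] Reg rn [+] Const 1)"

text \<open>\<open>aFL\<close> receives the padded deletion lists and \<open>aF\<close> their
  bitmap; slots past the end of a list keep their initial 0.\<close>

definition fill_body :: com where
  "fill_body =
     Assign rv (Reg rz [div] Reg r\<mu>);; Assign rl (Reg rz [mod] Reg r\<mu>);;
     Assign rpos (Read aOff (Reg rv));;
     If (Reg rl [<] Read aIn (Reg rpos))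
       (Assign ru (Read aIn (Reg rpos [+] Const 1 [+] Const 2 [*] Reg rl));;
        Assign rx (Read aIn (Reg rpos [+] Const 2 [+] Const 2 [*] Reg rl));;
        Assign ry (edge_code_exp ru rx);;
        Write aFL (Reg rz) (Reg ry);;
        Write aF (Reg rv [*] Reg rR [+] Reg ry) (Const 1))
       Skip;;
     Assign rz (Reg rz [+] Const 1)"

definition fill :: com where
  "fill =
     Assign rz (Const 0);; Assign rlim (Reg rn [*] Reg r\<mu>);;
     While (Reg rz [<] Reg rlim) fill_body"

definition new_row_body :: com where
  "new_row_body =
     If (Reg rd [div] Reg r\<mu> [=] Reg ri)
       (Assign ry (Read aFL (Reg rv [*] Reg r\<mu> [+] Reg rd [mod] Reg r\<mu>)))
       (Assign ry (Read aL (Reg rsrc [*] Reg rp [+] Reg rd)));;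
     Write aL (Reg rtgt [*] Reg rp [+] Reg rd) (Reg ry);;
     Write aM (Reg rtgt [*] Reg rR [+] Reg ry) (Const 1);;
     Assign rd (Reg rd [+] Const 1)"

definition new_row :: com where
  "new_row =
     Assign rd (Const 0);; Write aD (Reg rtgt) (Const 1);;
     While (Reg rd [<] Reg rp) new_row_body;;
     If (Reg rv [=] Reg rt) (Assign ans (Const 1)) Skip"

definition first_row :: com where
  "first_row =
     Assign ri (Const 0);; Assign rv (Reg rs);; Assign rsrc (Reg rs);; Assign rtgt (Reg rs);; new_row"

text \<open>The edge list starts at input position 5, so the number of an oriented edge is an offset
  into it. Conditions are multiplied as 0/1 values, with \<open>1 - x\<close> as negation.\<close>

definition decode :: com where
  "decode =
     Assign rq (Reg rz [div] Reg rP [mod] Reg rmm);;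
     Assign rph (Reg rz [div] Reg rP [div] Reg rmm);;
     Assign ri (Reg rph [div] Reg rP);;
     Assign ru (Read aIn (Const 5 [+] Reg rq));;
     Assign rv (Read aIn (Const 5 [+] (Reg rq [+] Const 1 [-] Const 2 [*] (Reg rq [mod] Const 2))));;
     Assign rsrc (((Reg ri [-] Const 1) [*] Reg rP [+] Reg rz [mod] Reg rP) [*] Reg rn [+] Reg ru);;
     Assign rtgt (Reg rph [*] Reg rn [+] Reg rv);;
     Assign ry (edge_code_exp ru rv);;
     Assign rok (Read aD (Reg rsrc) [*] (Const 1 [-] Read aD (Reg rtgt)) [*]
       (Const 1 [-] Read aM (Reg rsrc [*] Reg rR [+] Reg ry)));;
     Assign rx (Reg rph [mod] Reg rP)"

text \<open>Inverts the child formula \<open>x * p + d + 1\<close> to find the parent and the slot,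
  and multiplies the test of the edge chosen there into \<open>rok\<close>.\<close>

definition climb_body :: com where
  "climb_body =
     Assign ry (Read aL (((Reg ri [*] Reg rP [+] (Reg rx [-] Const 1) [div] Reg rp) [*] Reg rn [+] Reg rv)
       [*] Reg rp [+] (Reg rx [-] Const 1) [mod] Reg rp));;
     Assign rok (Reg rok [*] (Const 0 [<] Reg ry) [*]
       (Const 1 [-] Read aM (Reg rsrc [*] Reg rR [+] Reg ry)) [*]
       (Const 1 [-] Read aF (Reg rv [*] Reg rR [+] Reg ry)));;
     Assign rx ((Reg rx [-] Const 1) [div] Reg rp)"

definition main_body :: com where
  "main_body =
     decode;;
     While (Reg rx) climb_body;;
     If (Reg rok) new_row Skip;;
     Assign rz (Reg rz [+] Const 1)"

definition main_loop :: com where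
  "main_loop =
     Assign rmm (Const 2 [*] Reg rm);;
     Assign rz (Reg rP [*] Reg rmm [*] Reg rP);; Assign rlim (Reg rk [*] Reg rz);;
     While (Reg rz [<] Reg rlim) main_body"

definition solver :: com where
  "solver = read_header;; scan;; parameters;; fill;; first_row;; main_loop"

section \<open>Input layout, word length and preprocessed arrays\<close>

lemma length_flatten [simp]: "length (flatten ps) = 2 * length ps"
  by (induction ps) (auto simp: flatten_def)

text \<open>The bounds on \<open>w\<close> cover the input length, the large tables
  \<open>aM\<close> and \<open>aL\<close>, the range of the main loop and the array
  \<open>aFL\<close>. Other computed values stay within these bounds or are small constants, for
  which \<open>4 \<le> w\<close> is assumed.\<close>

locale machine = instance_data +
  fixes w :: nat and xs :: "nat list"
  assumes xs: "xs = [n, length es, s, t, k] @ flatten es @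
      concat (map (\<lambda>ps. length ps # flatten ps) fs)"
    and w: "4 \<le> w" and w_in: "length xs < 2 ^ w"
    and w_R: "k * P * n * R < 2 ^ w" and w_p: "k * P * n * p < 2 ^ w"
    and w_z: "k * z\<^sub>0 < 2 ^ w" and w_\<mu>: "n * \<mu>' < 2 ^ w"
begin

definition "inp = (\<lambda>i. if i < length xs then xs ! i else 0)"
definition "off v = 5 + 2 * m + (\<Sum>v'<v. 1 + 2 * length (fs ! v'))"
definition "FL = (\<lambda>q. if q < n * \<mu>' then del_code (q div \<mu>') (q mod \<mu>') else 0)"
text \<open>Contents of \<open>aF\<close> after \<open>N\<close> rounds of the loop in
  \<open>fill\<close>.\<close>

definition "F_upto N = (\<lambda>q. if \<exists>z<N. FL z \<noteq> 0 \<and> q = z div \<mu>' * R + FL z then 1 else 0 :: nat)"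
definition "F = F_upto (n * \<mu>')"

lemma flatten_nth:
  "j < length ps \<Longrightarrow> flatten ps ! (2 * j) = fst (ps ! j) \<and> flatten ps ! (2 * j + 1) = snd (ps ! j)"
proof (induction ps arbitrary: j)
  case (Cons a ps)
  have "flatten (a # ps) = fst a # snd a # flatten ps" by (simp add: flatten_def case_prod_beta)
  then show ?case using Cons by (cases j) auto
qed simp

lemma xs_header: "inp 0 = n" "inp (Suc 0) = m" "inp 2 = s" "inp 3 = t" "inp 4 = k"
  unfolding inp_def m_def by (simp_all add: xs eval_nat_numeral)

lemma length_xs: "length xs = off n"
proof -
  have "length (concat (map (\<lambda>ps. length ps # flatten ps) fs)) = (\<Sum>ps\<leftarrow>fs. 1 + 2 * length ps)"
    by (simp add: length_concat comp_def)
  also have "\<dots> = (\<Sum>v<n. 1 + 2 * length (fs ! v))"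
    by (simp add: sum_list_sum_nth length_fs atLeast0LessThan)
  finally show ?thesis by (simp add: xs off_def m_def)
qed

lemma inp_edge: "j < 2 * m \<Longrightarrow> inp (5 + j) = endpoint j"
proof -
  assume j: "j < 2 * m"
  have "5 + j < length xs" using j by (simp add: length_xs off_def)
  then have "inp (5 + j) = flatten es ! j"
    using j unfolding inp_def m_def by (simp add: xs nth_append)
  also have "\<dots> = endpoint j"
  proof -
    define h where "h = j div 2"
    have h: "h < length es" using j by (simp add: h_def m_def)
    show ?thesis
    proof (cases "even j")
      case True
      then have "j = 2 * h" by (simp add: h_def)
      then show ?thesis using flatten_nth[OF h] by (simp add: endpoint_def)
    next
      case False
      then have "j = 2 * h + 1" by (simp add: h_def)
      then show ?thesis using flatten_nth[OF h] by (simp add: endpoint_def)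
    qed
  qed
  finally show ?thesis .
qed

lemma off_Suc: "off (Suc v) = off v + 1 + 2 * length (fs ! v)"
  by (simp add: off_def)

lemma off_mono: "v \<le> v' \<Longrightarrow> off v \<le> off v'"
  by (induction rule: dec_induct) (simp_all add: off_Suc)

lemma inp_off:
  assumes v: "v < n" and i: "i < 1 + 2 * length (fs ! v)"
  shows "inp (off v + i) = (length (fs ! v) # flatten (fs ! v)) ! i"
proof -
  let ?g = "\<lambda>ps. length ps # flatten ps"
  have c: "concat (map ?g fs) =
      concat (map ?g (take v fs)) @ ?g (fs ! v) @ concat (map ?g (drop (Suc v) fs))"
    using v length_fs by (subst id_take_nth_drop[of v fs]) simp_all
  have "length (concat (map ?g (take v fs))) = (\<Sum>ps\<leftarrow>take v fs. 1 + 2 * length ps)"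
    by (simp add: length_concat comp_def)
  also have "\<dots> = (\<Sum>v'<v. 1 + 2 * length (fs ! v'))"
    using v by (simp add: sum_list_sum_nth length_fs atLeast0LessThan)
  finally have "off v = length ([n, length es, s, t, k] @ flatten es @ concat (map ?g (take v fs)))"
    by (simp add: off_def m_def)
  moreover have "xs = ([n, length es, s, t, k] @ flatten es @ concat (map ?g (take v fs))) @
      ?g (fs ! v) @ concat (map ?g (drop (Suc v) fs))"
    unfolding xs c by simp
  ultimately have "xs ! (off v + i) = ?g (fs ! v) ! i"
    using i by (simp only: nth_append_length_plus) (subst nth_append, simp)
  moreover have "off v + i < length xs"
    using off_mono[of "Suc v" n] v i by (simp add: off_Suc length_xs)
  ultimately show ?thesis by (simp add: inp_def)
qed

lemma inp_off_length: "v < n \<Longrightarrow> inp (off v) = length (fs ! v)"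
  using inp_off[of v 0] by simp

lemma inp_off_edge:
  assumes "v < n" and "l < length (fs ! v)"
  shows "inp (off v + 1 + 2 * l) = fst (fs ! v ! l)" "inp (off v + 2 + 2 * l) = snd (fs ! v ! l)"
  using inp_off[of v "1 + 2 * l"] inp_off[of v "2 + 2 * l"] flatten_nth[OF assms(2)] assms
  by simp_all

lemma FL_eq: "v < n \<Longrightarrow> l < \<mu>' \<Longrightarrow> FL (v * \<mu>' + l) = del_code v l"
  using row_index_less[of v n l \<mu>'] by (simp add: FL_def)

lemma FL_less: "FL q < R"
  using del_code_less R_pos \<mu>'_pos by (simp add: FL_def less_mult_imp_div_less)

lemma F_eq:
  assumes "v < n" and "0 < y" and "y < R"
  shows "F (v * R + y) \<noteq> 0 \<longleftrightarrow> y \<in> del_codes v"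
proof -
  have "(\<exists>z<n * \<mu>'. FL z \<noteq> 0 \<and> v * R + y = z div \<mu>' * R + FL z) \<longleftrightarrow> (\<exists>l<\<mu>'. del_code v l = y)"
  proof
    assume "\<exists>z<n * \<mu>'. FL z \<noteq> 0 \<and> v * R + y = z div \<mu>' * R + FL z"
    then obtain z where z: "z < n * \<mu>'" "v * R + y = z div \<mu>' * R + FL z" by blast
    from row_index_inj[OF z(2) assms(3) FL_less] have "v = z div \<mu>'" "y = FL z" by auto
    then show "\<exists>l<\<mu>'. del_code v l = y"
      using z(1) \<mu>'_pos by (intro exI[of _ "z mod \<mu>'"]) (simp add: FL_def)
  next
    assume "\<exists>l<\<mu>'. del_code v l = y"
    then obtain l where l: "l < \<mu>'" "del_code v l = y" by blast
    then show "\<exists>z<n * \<mu>'. FL z \<noteq> 0 \<and> v * R + y = z div \<mu>' * R + FL z"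
      using assms(1,2) FL_eq[OF assms(1) l(1)] row_index_less[OF assms(1) l(1)]
      by (intro exI[of _ "v * \<mu>' + l"]) simp
  qed
  then show ?thesis
    using assms(2) unfolding F_def F_upto_def del_codes_eq[OF assms(1)] by simp
qed

lemma F_le: "F q \<le> 1" by (simp add: F_def F_upto_def)

definition params :: "state \<Rightarrow> bool" where
  "params \<sigma> \<longleftrightarrow> fst \<sigma> rn = n \<and> fst \<sigma> rm = m \<and> fst \<sigma> rs = s \<and> fst \<sigma> rt = t \<and> fst \<sigma> rk = k \<and>
     fst \<sigma> r\<mu> = \<mu>' \<and> fst \<sigma> rp = p \<and> fst \<sigma> rP = P \<and> fst \<sigma> rnn = n * n \<and> fst \<sigma> rR = R \<and>
     snd \<sigma> aIn = inp \<and> snd \<sigma> aFL = FL \<and> snd \<sigma> aF = F"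

lemma small_less: "(x::nat) \<le> 15 \<Longrightarrow> x < 2 ^ w"
proof -
  assume "x \<le> 15"
  moreover have "(2::nat) ^ 4 \<le> 2 ^ w" using w by (intro power_increasing) simp_all
  ultimately show ?thesis by simp
qed

lemma kPn_pos: "0 < k" "0 < P" "0 < n" "0 < p" "0 < R" "0 < \<mu>'"
  using k P_pos n_pos p_pos R_pos \<mu>'_pos by auto

lemma fact_less:
  assumes "a * b < (2::nat) ^ w"
  shows "0 < b \<Longrightarrow> a < 2 ^ w" "0 < a \<Longrightarrow> b < 2 ^ w"
  using assms le_less_trans[of a "a * b"] le_less_trans[of b "a * b"] by auto

lemma bounds_w: "k < 2 ^ w" "P < 2 ^ w" "n < 2 ^ w" "p < 2 ^ w" "R < 2 ^ w" "\<mu>' < 2 ^ w"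
  "k * P < 2 ^ w" "k * P * n < 2 ^ w"
proof -
  have 1: "k * P * n < 2 ^ w" using fact_less(1)[OF w_R] kPn_pos by simp
  have 2: "k * P < 2 ^ w" using fact_less(1)[OF 1] kPn_pos by simp
  show "k * P * n < 2 ^ w" "k * P < 2 ^ w" by fact+
  show "k < 2 ^ w" "P < 2 ^ w" using fact_less[OF 2] kPn_pos by simp_all
  show "n < 2 ^ w" "p < 2 ^ w" "R < 2 ^ w" "\<mu>' < 2 ^ w"
    using fact_less(2)[OF 1] fact_less(2)[OF w_p] fact_less(2)[OF w_R] fact_less(2)[OF w_\<mu>] kPn_pos
    by simp_all
qed

lemma new_L_0 [simp]: "new_L L i v src tgt 0 = L"
  and new_M_0 [simp]: "new_M L M i v src tgt 0 = M"
  by (simp_all add: fun_eq_iff new_L_def new_M_def)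

lemma new_L_Suc: "new_L L i v src tgt (Suc d) =
    (new_L L i v src tgt d)(tgt * p + d := new_entry L i v src d)"
  by (rule ext) (auto simp: new_L_def less_Suc_eq)

lemma new_M_Suc: "new_M L M i v src tgt (Suc d) =
    (new_M L M i v src tgt d)(tgt * R + new_entry L i v src d := 1)"
  by (rule ext) (auto simp: new_M_def less_Suc_eq)

text \<open>Slot \<open>d\<close> is read just before it is written, so the value found is the old
  one even for \<open>src = tgt\<close>, as happens in \<open>first_row\<close>.\<close>

lemma new_L_src:
  assumes "d < p"
  shows "new_L L i v src tgt d (src * p + d) = L (src * p + d)"
proof -
  have "src * p + d \<noteq> tgt * p + d'" if "d' < d" for d'
    using row_index_inj[of src p d tgt d'] assms that by auto
  then show ?thesis by (auto simp: new_L_def)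
qed

section \<open>Correctness and cost of the pieces of the program\<close>

lemma wp_new_row:
  assumes par: "params \<sigma>"
    and reg: "fst \<sigma> ri = i" "fst \<sigma> rv = v" "fst \<sigma> rsrc = src" "fst \<sigma> rtgt = tgt"
    and bnd: "i < k" "v < n" "src < k * P * n" "tgt < k * P * n"
    and arr: "snd \<sigma> aD = D" "snd \<sigma> aL = L" "snd \<sigma> aM = M" "\<And>q. L q < R"
    and Q: "\<And>T \<tau>. T \<le> (p + 1) * 40 + 20 \<Longrightarrow> params \<tau> \<Longrightarrow>
      (\<forall>r. r \<noteq> ans \<and> r \<noteq> rd \<and> r \<noteq> ry \<longrightarrow> fst \<tau> r = fst \<sigma> r) \<Longrightarrow>
      fst \<tau> ans = (if v = t then 1 else fst \<sigma> ans) \<Longrightarrow>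
      snd \<tau> aD = D(tgt := 1) \<Longrightarrow> snd \<tau> aL = new_L L i v src tgt p \<Longrightarrow>
      snd \<tau> aM = new_M L M i v src tgt p \<Longrightarrow> Q T \<tau>"
  shows "wp w new_row \<sigma> Q"
proof -
  define I where "I j \<tau> \<longleftrightarrow> params \<tau> \<and>
    (\<forall>r. r \<noteq> rd \<and> r \<noteq> ry \<longrightarrow> fst \<tau> r = fst \<sigma> r) \<and>
    snd \<tau> aD = D(tgt := 1) \<and> snd \<tau> aL = new_L L i v src tgt j \<and>
    snd \<tau> aM = new_M L M i v src tgt j" for j \<tau>
  have tw: "tgt < 2 ^ w" "src < 2 ^ w" "i < 2 ^ w" "v < 2 ^ w"
    using bnd bounds_w by linarith+
  have body: "wp w new_row_body \<tau> (\<lambda>T \<tau>. T \<le> 36 \<and> fst \<tau> rd = Suc j \<and> I (Suc j) \<tau>)"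
    if j: "j < p" and I: "I j \<tau>" and d: "fst \<tau> rd = j" for j \<tau>
  proof -
    define y where "y = new_entry L i v src j"
    have y: "y < R" unfolding y_def using new_entry_less[OF bnd(2) arr(4)] .
    have dm: "j mod \<mu>' < \<mu>'" "j div \<mu>' \<le> j" using \<mu>'_pos by simp_all
    have f1: "v * \<mu>' + j mod \<mu>' < n * \<mu>'" using bnd(2) dm(1) by (rule row_index_less)
    have f2: "src * p + j < k * P * n * p" using bnd(3) j by (rule row_index_less)
    have f3: "tgt * p + j < k * P * n * p" using bnd(4) j by (rule row_index_less)
    have f4: "tgt * R + y < k * P * n * R" using bnd(4) y by (rule row_index_less)
    have le: "v * \<mu>' + j mod \<mu>' < 2 ^ w" "v * \<mu>' < 2 ^ w" "j mod \<mu>' < 2 ^ w" "j div \<mu>' < 2 ^ w"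
      "src * p + j < 2 ^ w" "src * p < 2 ^ w" "tgt * p + j < 2 ^ w" "tgt * p < 2 ^ w"
      "tgt * R + y < 2 ^ w" "tgt * R < 2 ^ w" "y < 2 ^ w" "j < 2 ^ w" "Suc j < 2 ^ w"
      using f1 f2 f3 f4 w_\<mu> w_p w_R y j dm bounds_w by linarith+
    have sm: "Suc 0 < 2 ^ w" "0 < (2::nat) ^ w" using small_less[of 1] by simp_all
    note regs = I[unfolded I_def params_def] reg bounds_w tw sm d le
    have fl: "FL (v * \<mu>' + j mod \<mu>') = del_code v (j mod \<mu>')" using FL_eq[OF bnd(2) dm(1)] .
    have y1: "y = del_code v (j mod \<mu>')" if "j div \<mu>' = i" using that by (simp add: y_def new_entry_def)
    have y2: "y = L (src * p + j)" if "j div \<mu>' \<noteq> i" using that by (simp add: y_def new_entry_def)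
    show ?thesis
      unfolding new_row_body_def
      by (cases "j div \<mu>' = i")
        (simp_all add: regs fl y1[symmetric] y2[symmetric] new_L_src[OF j] I_def params_def
          new_L_Suc new_M_Suc y_def[symmetric])
  qed
  show ?thesis unfolding new_row_def
    apply (simp add: reg par[unfolded params_def] tw small_less bounds_w)
    apply (rule wp_For[where r = rd and I = I and N = p and a = 0 and B = 36])
    subgoal by simp
    subgoal by simp
    subgoal using par arr by (simp add: I_def params_def)
    subgoal by (simp add: I_def params_def bounds_w)
    subgoal by (rule body)
    subgoal using w by simp
    subgoal premises prems for \<tau> T
    proof -
      have par': "params \<tau>" and fr: "\<And>r. r \<noteq> rd \<Longrightarrow> r \<noteq> ry \<Longrightarrow> fst \<tau> r = fst \<sigma> r"
        and arr': "snd \<tau> aD = D(tgt := 1)" "snd \<tau> aL = new_L L i v src tgt p"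
          "snd \<tau> aM = new_M L M i v src tgt p"
        using prems(1) by (simp_all add: I_def)
      have rv: "fst \<tau> rv = v" "fst \<tau> rt = t" "t < 2 ^ w"
        using fr[of rv] reg par' t bounds_w by (simp_all add: params_def)
      have T: "T + 20 \<le> (p + 1) * 40 + 20" using prems(3) by simp
      show ?thesis
      proof (cases "v = t")
        case True
        have "params ((fst \<tau>)(0 := Suc 0), snd \<tau>)" using par' by (simp add: params_def)
        then show ?thesis unfolding rv using True rv(3) T
          by (auto intro!: Q simp: fr arr')
      next
        case False
        then show ?thesis unfolding rv using tw rv(3) T par'
          by (auto intro!: Q simp: fr arr')
      qed
    qed
    done
qed

definition "A\<^sub>0 = (\<lambda>a :: nat. if a = 0 then inp else (\<lambda>_. 0))"

definition header :: "state \<Rightarrow> bool" where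
  "header \<sigma> \<longleftrightarrow> fst \<sigma> ans = 0 \<and> fst \<sigma> rn = n \<and> fst \<sigma> rm = m \<and> fst \<sigma> rs = s \<and> fst \<sigma> rt = t \<and> fst \<sigma> rk = k"

lemma length_xs_ge: "5 + 2 * m \<le> length xs" "5 + 2 * m + n \<le> length xs"
proof -
  have "n = (\<Sum>v'<n. 1)" by simp
  also have "\<dots> \<le> (\<Sum>v'<n. 1 + 2 * length (fs ! v'))" by (intro sum_mono) simp
  finally show "5 + 2 * m + n \<le> length xs" by (simp add: length_xs off_def)
  then show "5 + 2 * m \<le> length xs" by simp
qed

lemma wp_read_header:
  assumes Q: "\<And>T \<tau>. T \<le> 20 \<Longrightarrow> header \<tau> \<Longrightarrow> snd \<tau> = A\<^sub>0 \<Longrightarrow> Q T \<tau>"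
  shows "wp w read_header (initial_state xs) Q"
proof -
  have 0: "snd (initial_state xs) = A\<^sub>0" "fst (initial_state xs) = (\<lambda>_. 0)"
    by (auto simp: initial_state_def A\<^sub>0_def inp_def fun_eq_iff)
  have 1: "m < 2 ^ w" "s < 2 ^ w" "t < 2 ^ w" using length_xs_ge(1) w_in bounds_w s t by linarith+
  have 2: "A\<^sub>0 0 = inp" by (simp add: A\<^sub>0_def)
  show ?thesis unfolding read_header_def
    using small_less[of 1] small_less[of 0] small_less[of 2] small_less[of 3] small_less[of 4]
    by (simp add: 0 1 2 xs_header bounds_w) (rule Q; simp add: header_def)
qed

lemma wp_scan:
  assumes h: "header \<sigma>" and A: "snd \<sigma> = A\<^sub>0"
    and Q: "\<And>T \<tau>. T \<le> (n + 1) * 40 + 20 \<Longrightarrow> header \<tau> \<Longrightarrow> fst \<tau> r\<mu> + 1 = \<mu>' \<Longrightarrow>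
      snd \<tau> = A\<^sub>0(aOff := (\<lambda>q. if q < n then off q else 0)) \<Longrightarrow> Q T \<tau>"
  shows "wp w scan \<sigma> Q"
proof -
  \<comment> \<open>The inserted 0 provides a maximum for \<open>v = 0\<close> and matches the
    initial value of the register.\<close>
  define mx where "mx v = Max (insert 0 ((\<lambda>v. length (fs ! v)) ` {..<v}))" for v
  define I where "I v \<tau> \<longleftrightarrow> header \<tau> \<and> fst \<tau> rpos = off v \<and> fst \<tau> r\<mu> = mx v \<and>
    snd \<tau> = A\<^sub>0(aOff := (\<lambda>q. if q < v then off q else 0))" for v \<tau>
  have mx_Suc: "mx (Suc v) = max (mx v) (length (fs ! v))" for v
    unfolding mx_def lessThan_Suc image_insert
    by (subst insert_commute, subst Max_insert) (simp_all add: max.commute)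
  have mx_less: "mx v < \<mu>'" if "v \<le> n" for v
    unfolding mx_def using that length_fs_less \<mu>'_pos by (subst Max_less_iff) auto
  have "mx n = max_deletions {..<n} f"
  proof -
    have "(\<lambda>v. length (fs ! v)) ` {..<n} = (\<lambda>v. card (f v)) ` {..<n}"
      by (intro image_cong refl) (simp add: length_fs_nth)
    then show ?thesis using n_pos unfolding mx_def max_deletions_def by (subst Max_insert) auto
  qed
  then have mx_n: "Suc (mx n) = \<mu>'" by (simp add: \<mu>'_def)
  have A0: "A\<^sub>0 0 = inp" "A\<^sub>0 2 = (\<lambda>_. 0)" by (simp_all add: A\<^sub>0_def)
  have body: "wp w scan_body \<tau> (\<lambda>T \<tau>. T \<le> 36 \<and> fst \<tau> rv = Suc v \<and> I (Suc v) \<tau>)"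
    if v: "v < n" and I: "I v \<tau>" and d: "fst \<tau> rv = v" for v \<tau>
  proof -
    have "off (Suc v) \<le> length xs" using off_mono[of "Suc v" n] v by (simp add: length_xs)
    then have "off v + 1 + 2 * length (fs ! v) < 2 ^ w" using w_in by (simp add: off_Suc)
    moreover have "mx v < 2 ^ w" using mx_less[of v] v bounds_w by linarith
    moreover have "v < 2 ^ w" "Suc v < 2 ^ w" using v bounds_w by linarith+
    ultimately show ?thesis
      unfolding scan_body_def
      using I d v small_less[of 1] small_less[of 2] small_less[of 0]
      by (auto simp: I_def header_def inp_off_length off_Suc mx_Suc fun_eq_iff A0)
  qed
  have "5 + 2 * m < 2 ^ w" using length_xs_ge(1) w_in by simp
  show ?thesis unfolding scan_def
    using h small_less[of 5] small_less[of 2] small_less[of 0] \<open>5 + 2 * m < 2 ^ w\<close>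
    apply (simp add: header_def)
    apply (rule wp_For[where r = rv and I = I and N = n and a = 0 and B = 36])
    subgoal by simp
    subgoal by simp
    subgoal using A by (simp add: I_def header_def off_def mx_def A0 fun_eq_iff)
    subgoal by (simp add: I_def header_def bounds_w)
    subgoal by (rule body)
    subgoal using w by simp
    subgoal by (rule Q) (simp_all add: I_def mx_n)
    done
qed

lemma nn_less: "n * n < 2 ^ w" "2 * n < 2 ^ w" "2 * n * n < 2 ^ w" "2 * n * n * n < 2 ^ w"
proof -
  have "n * n \<le> 2 * n * n" "2 * n \<le> 2 * n * n" "2 * n * n \<le> 2 * n * n * n"
    using n_pos by simp_all
  then show "n * n < 2 ^ w" "2 * n < 2 ^ w" "2 * n * n < 2 ^ w" "2 * n * n * n < 2 ^ w"
    using bounds_w(5) unfolding R_def by linarith+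
qed

lemma wp_parameters:
  assumes h: "header \<sigma>" and \<mu>: "fst \<sigma> r\<mu> + 1 = \<mu>'"
    and Q: "\<And>T \<tau>. T \<le> (k + 1) * 24 + 40 \<Longrightarrow> header \<tau> \<Longrightarrow> fst \<tau> r\<mu> = \<mu>' \<Longrightarrow> fst \<tau> rp = p \<Longrightarrow>
      fst \<tau> rP = P \<Longrightarrow> fst \<tau> rnn = n * n \<Longrightarrow> fst \<tau> rR = R \<Longrightarrow> snd \<tau> = snd \<sigma> \<Longrightarrow> Q T \<tau>"
  shows "wp w parameters \<sigma> Q"
proof -
  define I where "I j \<tau> \<longleftrightarrow> header \<tau> \<and> fst \<tau> r\<mu> = \<mu>' \<and> fst \<tau> rp = p \<and>
    fst \<tau> rP = (p + 1) ^ j \<and> snd \<tau> = snd \<sigma>" for j \<tau>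
  \<comment> \<open>No intermediate power overflows, since each is at most \<open>P\<close>.\<close>
  have pw: "(p + 1) ^ j < 2 ^ w" if "j \<le> k" for j
    using power_increasing[OF that, of "p + 1"] bounds_w(2) unfolding P_def by simp
  have p1: "p + 1 < 2 ^ w" using pw[of 1] k by simp
  have body: "wp w (Assign rP (Reg rP [*] (Reg rp [+] Const 1));; Assign rd (Reg rd [+] Const 1)) \<tau>
      (\<lambda>T \<tau>. T \<le> 20 \<and> fst \<tau> rd = Suc j \<and> I (Suc j) \<tau>)"
    if j: "j < k" and I: "I j \<tau>" and d: "fst \<tau> rd = j" for j \<tau>
    using I d j small_less[of 1] pw[of j] pw[of "Suc j"] p1 bounds_w
    by (simp add: I_def header_def algebra_simps)
  have R: "Suc (2 * n * n * n) < 2 ^ w" using bounds_w(5) by (simp add: R_def)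
  have m1: "fst \<sigma> r\<mu> < 2 ^ w" "k < 2 ^ w" using \<mu> bounds_w by linarith+
  show ?thesis unfolding parameters_def
    using h \<mu> small_less[of 1] small_less[of 0] bounds_w m1
    apply (simp add: header_def p_def[symmetric])
    apply (rule wp_For[where r = rd and I = I and N = k and a = 0 and B = 20])
    subgoal by simp
    subgoal by simp
    subgoal by (simp add: I_def header_def p_def)
    subgoal by (simp add: I_def header_def)
    subgoal by (rule body[unfolded One_nat_def])
    subgoal using w by simp
    subgoal using small_less[of 2] small_less[of 1] R nn_less
      by (simp add: I_def header_def) (rule Q; simp add: header_def P_def R_def)
    done
qed

lemma wp_fill:
  assumes h: "header \<sigma>" "fst \<sigma> r\<mu> = \<mu>'" "fst \<sigma> rp = p" "fst \<sigma> rP = P" "fst \<sigma> rnn = n * n"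
      "fst \<sigma> rR = R" "snd \<sigma> = A\<^sub>0(aOff := (\<lambda>q. if q < n then off q else 0))"
    and Q: "\<And>T \<tau>. T \<le> (n * \<mu>' + 1) * 100 + 20 \<Longrightarrow> params \<tau> \<Longrightarrow> fst \<tau> ans = 0 \<Longrightarrow>
      snd \<tau> aD = (\<lambda>_. 0) \<Longrightarrow> snd \<tau> aL = (\<lambda>_. 0) \<Longrightarrow> snd \<tau> aM = (\<lambda>_. 0) \<Longrightarrow> Q T \<tau>"
  shows "wp w fill \<sigma> Q"
proof -
  define FL' where "FL' N = (\<lambda>q. if q < N then FL q else 0)" for N
  define I where "I j \<tau> \<longleftrightarrow> header \<tau> \<and> fst \<tau> r\<mu> = \<mu>' \<and> fst \<tau> rp = p \<and> fst \<tau> rP = P \<and>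
    fst \<tau> rnn = n * n \<and> fst \<tau> rR = R \<and> fst \<tau> rlim = n * \<mu>' \<and>
    snd \<tau> aIn = inp \<and> snd \<tau> aOff = (\<lambda>q. if q < n then off q else 0) \<and>
    snd \<tau> aFL = FL' j \<and> snd \<tau> aF = F_upto j \<and>
    snd \<tau> aD = (\<lambda>_. 0) \<and> snd \<tau> aL = (\<lambda>_. 0) \<and> snd \<tau> aM = (\<lambda>_. 0)" for j \<tau>
  have FL'_Suc: "FL' (Suc j) = (FL' j)(j := FL j)" for j
    by (auto simp: FL'_def fun_eq_iff less_Suc_eq)
  have F_Suc: "F_upto (Suc j) = (if FL j = 0 then F_upto j
      else (F_upto j)(j div \<mu>' * R + FL j := 1))" for j
    by (auto simp: F_upto_def fun_eq_iff less_Suc_eq)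
  have body: "wp w fill_body \<tau> (\<lambda>T \<tau>. T \<le> 90 \<and> fst \<tau> rz = Suc j \<and> I (Suc j) \<tau>)"
    if j: "j < n * \<mu>'" and I: "I j \<tau>" and d: "fst \<tau> rz = j" for j \<tau>
  proof -
    define v where "v = j div \<mu>'"
    define l where "l = j mod \<mu>'"
    have vl: "v < n" "l < \<mu>'" using j \<mu>'_pos unfolding v_def l_def by (simp_all add: less_mult_imp_div_less)
    have le: "v < 2 ^ w" "l < 2 ^ w" "j < 2 ^ w" "Suc j < 2 ^ w"
      using vl j bounds_w w_\<mu> by linarith+
    have "off (Suc v) \<le> length xs" using off_mono[of "Suc v" n] vl by (simp add: length_xs)
    then have off: "off v + 1 + 2 * length (fs ! v) < 2 ^ w" using w_in by (simp add: off_Suc)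
    have FLj: "FL j = del_code v l" using j by (simp add: FL_def v_def l_def)
    note I' = I[unfolded I_def header_def]
    note sm = small_less[of 0] small_less[of 1] small_less[of 2]
    show ?thesis
    proof (cases "l < length (fs ! v)")
      case False
      then have "FL j = 0" by (simp add: FLj del_code_def)
      then have "FL' (Suc j) = FL' j" "F_upto (Suc j) = F_upto j"
        by (simp_all add: FL'_Suc F_Suc) (auto simp: FL'_def)
      with False show ?thesis
        unfolding fill_body_def
        using I' d vl le off sm bounds_w inp_off_length[OF vl(1)]
        by (simp add: I_def header_def v_def[symmetric] l_def[symmetric])
    next
      case True
      define a where "a = fst (fs ! v ! l)"
      define b where "b = snd (fs ! v ! l)"
      have ab: "a < n" "b < n" using fs_nth_bounds[OF vl(1) True] by (simp_all add: a_def b_def)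
      have abw: "a < 2 ^ w" "b < 2 ^ w" using ab bounds_w by linarith+
      define y where "y = edge_code n a b"
      have y: "y < R" using edge_code_less[OF ab] by (simp add: y_def R_def)
      have yF: "FL j = y" using True by (simp add: FLj del_code_def y_def a_def b_def)
      have y0: "y \<noteq> 0" by (simp add: y_def)
      have yeq: "Suc ((a + b) * (n * n) + a * b) = y" by (simp add: y_def edge_code_def)
      have yeq': "Suc (v * R + ((a + b) * (n * n) + a * b)) = v * R + y" using yeq by simp
      have ye: "(a + b) * (n * n) < 2 ^ w" "a * b < 2 ^ w" "(a + b) * (n * n) + a * b < 2 ^ w" "y < 2 ^ w"
        using yeq y bounds_w(5) by linarith+
      have "a + b \<le> (a + b) * (n * n)" using n_pos by simp
      then have ab2: "a + b < 2 ^ w" using ye(1) by (rule le_less_trans)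
      have nn: "n * n < 2 ^ w" by (rule nn_less)
      have "v * R + y < n * R" using vl(1) y by (rule row_index_less)
      also have "n * R \<le> k * P * n * R" using kPn_pos by (simp add: Suc_leI)
      finally have vR: "v * R + y < 2 ^ w" "v * R < 2 ^ w" using w_R by linarith+
      have e: "inp (Suc (off v + 2 * l)) = a" "inp (Suc (Suc (off v + 2 * l))) = b"
        using inp_off_edge[OF vl(1) True] by (simp_all add: a_def b_def)
      have offl: "Suc (off v + 2 * l) < 2 ^ w" "Suc (Suc (off v + 2 * l)) < 2 ^ w" "Suc (off v) < 2 ^ w"
        "Suc (Suc (off v)) < 2 ^ w" "2 * l < 2 ^ w" "off v < 2 ^ w" "length (fs ! v) < 2 ^ w"
        using off True by linarith+
      show ?thesis
        unfolding fill_body_def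
        using I' d vl le offl sm bounds_w inp_off_length[OF vl(1)] True
        by (simp add: I_def header_def v_def[symmetric] l_def[symmetric] e yeq yeq' ye abw ab2 nn vR
            FL'_Suc F_Suc yF y0)
    qed
  qed
  have FLn: "FL' (n * \<mu>') = FL" by (auto simp: FL'_def FL_def fun_eq_iff)
  show ?thesis unfolding fill_def
    using h small_less[of 0] bounds_w w_\<mu>
    apply (simp add: header_def)
    apply (rule wp_For[where r = rz and I = I and N = "n * \<mu>'" and a = 0 and B = 90])
    subgoal by simp
    subgoal by simp
    subgoal by (simp add: I_def header_def A\<^sub>0_def FL'_def F_upto_def)
    subgoal by (simp add: I_def)
    subgoal by (rule body)
    subgoal using w by simp
    subgoal by (rule Q) (simp_all add: I_def header_def params_def FLn F_def)
    done
qed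

lemma wp_first_row:
  assumes par: "params \<sigma>" and "fst \<sigma> ans = 0"
    and arr: "snd \<sigma> aD = (\<lambda>_. 0)" "snd \<sigma> aL = (\<lambda>_. 0)" "snd \<sigma> aM = (\<lambda>_. 0)"
    and Q: "\<And>T \<tau>. T \<le> (p + 1) * 40 + 40 \<Longrightarrow> params \<tau> \<Longrightarrow>
      table_inv (snd \<tau> aD) (snd \<tau> aL) (snd \<tau> aM) z\<^sub>0 \<Longrightarrow>
      fst \<tau> ans = (if \<exists>r. snd \<tau> aD r \<noteq> 0 \<and> r mod n = t then 1 else 0) \<Longrightarrow> Q T \<tau>"
  shows "wp w first_row \<sigma> Q"
proof -
  have sw: "s < 2 ^ w" "0 < (2::nat) ^ w" using s bounds_w by linarith+
  have "0 * n + s < k * P * n" using s kPn_pos by (intro row_index_less) simp_all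
  then have sk: "s < k * P * n" by simp
  have st: "(\<exists>r. ((\<lambda>_. 0)(s := Suc 0)) r \<noteq> (0::nat) \<and> r mod n = t) \<longleftrightarrow> s = t"
    using s by auto
  show ?thesis unfolding first_row_def
    using par sw small_less[of 0]
    apply (simp add: params_def)
    apply (rule wp_new_row[where i = 0 and v = s and src = s and tgt = s and D = "\<lambda>_. 0"
        and L = "\<lambda>_. 0" and M = "\<lambda>_. 0"])
    subgoal by (simp add: params_def)
    subgoal by simp
    subgoal by simp
    subgoal by simp
    subgoal by simp
    subgoal using k by simp
    subgoal by (rule s)
    subgoal by (rule sk)
    subgoal by (rule sk)
    subgoal using arr by simp
    subgoal using arr by simp
    subgoal using arr by simp
    subgoal by (rule R_pos)
    subgoal premises prems for T \<tau>
    proof -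
      have "snd \<tau> 5 = (\<lambda>_. 0)(s := Suc 0)" "snd \<tau> 6 = new_L (\<lambda>_. 0) 0 s s s p"
        "snd \<tau> 7 = new_M (\<lambda>_. 0) (\<lambda>_. 0) 0 s s s p"
        using prems(7-9) by simp_all
      note arr' = this
      show ?thesis
      proof (rule Q)
        show "table_inv (snd \<tau> 5) (snd \<tau> 6) (snd \<tau> 7) z\<^sub>0"
          unfolding arr' using table_inv_init by simp
        show "fst \<tau> 0 = (if \<exists>r. snd \<tau> 5 r \<noteq> 0 \<and> r mod n = t then 1 else 0)"
          unfolding arr' st using prems(6) assms(2) by simp
      qed (use prems in simp_all)
    qed
    done
qed

text \<open>The test of \<open>climb_body\<close> for one branch, with the bitmap \<open>F\<close>
  in place of \<open>del_codes\<close>.\<close>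

definition climb_ok :: "(nat \<Rightarrow> nat) \<Rightarrow> (nat \<Rightarrow> nat) \<Rightarrow> nat \<Rightarrow> nat \<Rightarrow> nat \<Rightarrow> nat \<times> nat \<Rightarrow> bool" where
  "climb_ok L M i v src = (\<lambda>(x, d). let y = L (((i * P + x) * n + v) * p + d) in
     y \<noteq> 0 \<and> M (src * R + y) = 0 \<and> F (v * R + y) = 0)"

text \<open>The node number itself serves as the measure, since parents are smaller. The resulting
  bound of \<open>P\<close> rounds is crude compared with the depth, but the extra factor disappears
  in the exponent.\<close>

lemma wp_climb:
  assumes par: "params \<sigma>"
    and reg: "fst \<sigma> ri = i" "fst \<sigma> rv = v" "fst \<sigma> rsrc = src" "fst \<sigma> rx = c" "fst \<sigma> rok \<le> 1"
    and bnd: "i < k" "v < n" "src < k * P * n" "c < P"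
    and arr: "snd \<sigma> aL = L" "snd \<sigma> aM = M" "\<And>q. L q < R" "\<And>q. M q \<le> 1"
    and Q: "\<And>T \<tau>. T \<le> (P + 1) * 62 \<Longrightarrow> params \<tau> \<Longrightarrow>
      (\<forall>r. r \<noteq> rx \<and> r \<noteq> ry \<and> r \<noteq> rok \<longrightarrow> fst \<tau> r = fst \<sigma> r) \<Longrightarrow> snd \<tau> = snd \<sigma> \<Longrightarrow>
      fst \<tau> rok \<le> 1 \<Longrightarrow> (fst \<tau> rok \<noteq> 0 \<longleftrightarrow>
        fst \<sigma> rok \<noteq> 0 \<and> (\<forall>b\<in>branches p c. climb_ok L M i v src b)) \<Longrightarrow> Q T \<tau>"
  shows "wp w (While (Reg rx) climb_body) \<sigma> Q"
proof -
  define G where "G = climb_ok L M i v src"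
  \<comment> \<open>The verdict so far, combined with the branches still ahead of node
    \<open>j\<close>, always equals the final verdict; at the root no branches are left.\<close>
  define I where "I j \<tau> \<longleftrightarrow> params \<tau> \<and>
      (\<forall>r. r \<noteq> rx \<and> r \<noteq> ry \<and> r \<noteq> rok \<longrightarrow> fst \<tau> r = fst \<sigma> r) \<and> snd \<tau> = snd \<sigma> \<and>
      fst \<tau> rx = j \<and> j \<le> c \<and> fst \<tau> rok \<le> 1 \<and>
      (fst \<tau> rok \<noteq> 0 \<and> (\<forall>b\<in>branches p j. G b) \<longleftrightarrow>
        fst \<sigma> rok \<noteq> 0 \<and> (\<forall>b\<in>branches p c. G b))" for j \<tau>
  have body: "wp w climb_body \<tau> (\<lambda>T \<tau>. T \<le> 60 \<and> (\<exists>j'<j. I j' \<tau>))"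
    if I: "I j \<tau>" and j0: "j \<noteq> 0" for j \<tau>
  proof -
    obtain j1 where j1: "j = Suc j1" using j0 by (cases j) auto
    define x where "x = j1 div p"
    define d where "d = j1 mod p"
    have "x \<le> j1" unfolding x_def by (rule div_le_dividend)
    have xP: "x < P" "j1 < P" "x < j" "x \<le> c" using I bnd(4) \<open>x \<le> j1\<close> unfolding j1 I_def by linarith+
    have d: "d < p" unfolding d_def using kPn_pos by simp
    define y where "y = L (((i * P + x) * n + v) * p + d)"
    have y: "y < R" unfolding y_def by (rule arr(3))
    have f1: "i * P + x < k * P" using bnd(1) xP(1) by (rule row_index_less)
    have f2: "(i * P + x) * n + v < k * P * n" using f1 bnd(2) by (rule row_index_less)
    have f3: "((i * P + x) * n + v) * p + d < k * P * n * p" using f2 d by (rule row_index_less)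
    have f4: "src * R + y < k * P * n * R" using bnd(3) y by (rule row_index_less)
    have f5: "v * R + y < n * R" using bnd(2) y by (rule row_index_less)
    have "n * R \<le> k * P * n * R" using kPn_pos by (simp add: Suc_leI)
    then have le: "i * P + x < 2 ^ w" "i * P < 2 ^ w" "(i * P + x) * n + v < 2 ^ w"
      "(i * P + x) * n < 2 ^ w" "((i * P + x) * n + v) * p < 2 ^ w"
      "((i * P + x) * n + v) * p + d < 2 ^ w" "src * R + y < 2 ^ w" "src * R < 2 ^ w"
      "v * R + y < 2 ^ w" "v * R < 2 ^ w" "y < 2 ^ w" "d < 2 ^ w" "x < 2 ^ w" "j1 < 2 ^ w" "Suc j1 < 2 ^ w"
      "i < 2 ^ w" "v < 2 ^ w" "src < 2 ^ w"
      using f1 f2 f3 f4 f5 w_R w_p bounds_w y d xP bnd I unfolding I_def j1 by linarith+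
    have br: "branches p j = insert (x, d) (branches p x)" by (simp add: j1 x_def d_def)
    have G: "G (x, d) \<longleftrightarrow> y \<noteq> 0 \<and> M (src * R + y) = 0 \<and> F (v * R + y) = 0"
      by (simp add: G_def climb_ok_def y_def Let_def)
    have par': "params \<tau>" and fr: "\<And>r. r \<noteq> rx \<Longrightarrow> r \<noteq> ry \<Longrightarrow> r \<noteq> rok \<Longrightarrow> fst \<tau> r = fst \<sigma> r"
      and sn: "snd \<tau> = snd \<sigma>" and rx: "fst \<tau> rx = Suc j1" and ok: "fst \<tau> rok \<le> 1"
      and eqv: "fst \<tau> rok \<noteq> 0 \<and> (\<forall>b\<in>branches p j. G b) \<longleftrightarrow>
        fst \<sigma> rok \<noteq> 0 \<and> (\<forall>b\<in>branches p c. G b)"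
      using I by (simp_all add: I_def j1)
    define ok' where "ok' = fst \<tau> rok * (if 0 < y then 1 else 0) *
      (1 - M (src * R + y)) * (1 - F (v * R + y))"
    have "fst \<tau> rok = 0 \<or> fst \<tau> rok = 1" "M (src * R + y) = 0 \<or> M (src * R + y) = 1"
        "F (v * R + y) = 0 \<or> F (v * R + y) = 1"
      using ok arr(4)[of "src * R + y"] F_le[of "v * R + y"] by linarith+
    note cases = this
    have ok': "ok' \<le> 1" "ok' \<noteq> 0 \<longleftrightarrow> fst \<tau> rok \<noteq> 0 \<and> G (x, d)"
      using cases by (auto simp: ok'_def G)
    have I': "I x \<tau>'" if "fst \<tau>' = (fst \<tau>)(ry := y, rok := ok', rx := x)" "snd \<tau>' = snd \<tau>" for \<tau>'
      unfolding I_def that using par' fr sn xP(4) ok' eqv[unfolded br]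
      by (auto simp: params_def that)
    have sm: "Suc 0 < 2 ^ w" "0 < (2::nat) ^ w" using small_less[of 1] by simp_all
    have regs: "fst \<tau> ri = i" "fst \<tau> rv = v" "fst \<tau> rsrc = src" "fst \<tau> rP = P" "fst \<tau> rp = p"
        "fst \<tau> rn = n" "fst \<tau> rR = R" "snd \<sigma> aF = F"
      using fr reg par par' by (simp_all add: params_def)
    have "wp w climb_body \<tau> (\<lambda>T \<tau>'. T \<le> 60 \<and>
        fst \<tau>' = (fst \<tau>)(ry := y, rok := ok', rx := x) \<and> snd \<tau>' = snd \<tau>)"
      unfolding climb_body_def ok'_def
      by (insert cases, cases "y = 0"; elim disjE; simp add: regs rx sn arr x_def[symmetric]
        d_def[symmetric] y_def[symmetric] le sm bounds_w)
    then show ?thesis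
      by (rule wp_mono) (use I' xP(3) in blast)
  qed
  show ?thesis
  proof (rule wp_While[where I = I and j = c and B = 60])
    show "I c \<sigma>" using par reg by (simp add: I_def)
  next
    fix j \<tau> assume I: "I j \<tau>"
    then show "fits w \<tau> (Reg rx)" using bnd(4) bounds_w by (simp add: I_def)
    assume "val \<tau> (Reg rx) \<noteq> 0"
    then have "j \<noteq> 0" using I by (simp add: I_def)
    with I show "wp w climb_body \<tau> (\<lambda>T \<tau>. T \<le> 60 \<and> (\<exists>j'<j. I j' \<tau>))" by (rule body)
  next
    fix j \<tau> T assume I: "I j \<tau>" and 0: "val \<tau> (Reg rx) = 0"
      and T: "T \<le> (c + 1) * (1 + cost (Reg rx) + 60)"
    have "j = 0" using I 0 by (simp add: I_def)
    then show "Q T \<tau>" using I T bnd(4) by (intro Q) (auto simp: I_def G_def)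
  qed
qed

lemma wp_decode:
  assumes par: "params \<sigma>" and reg: "fst \<sigma> rmm = 2 * m" "fst \<sigma> rz = z"
    and z: "z\<^sub>0 \<le> z" "z < k * z\<^sub>0"
    and arr: "snd \<sigma> aD = D" "snd \<sigma> aM = M" "\<And>q. D q \<le> 1" "\<And>q. M q \<le> 1"
    and Q: "\<And>T \<tau>. T \<le> 140 \<Longrightarrow> params \<tau> \<Longrightarrow> snd \<tau> = snd \<sigma> \<Longrightarrow>
      fst \<tau> rmm = 2 * m \<Longrightarrow> fst \<tau> rz = z \<Longrightarrow> fst \<tau> rlim = fst \<sigma> rlim \<Longrightarrow> fst \<tau> ans = fst \<sigma> ans \<Longrightarrow>
      fst \<tau> ri = phase z div P \<Longrightarrow> fst \<tau> rv = head z \<Longrightarrow> fst \<tau> rsrc = source z \<Longrightarrow>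
      fst \<tau> rtgt = target z \<Longrightarrow> fst \<tau> rx = phase z mod P \<Longrightarrow> fst \<tau> rok \<le> 1 \<Longrightarrow>
      (fst \<tau> rok \<noteq> 0 \<longleftrightarrow> D (source z) \<noteq> 0 \<and> D (target z) = 0 \<and>
        M (source z * R + edge_code n (tail z) (head z)) = 0) \<Longrightarrow> Q T \<tau>"
  shows "wp w decode \<sigma> Q"
proof -
  define q where "q = z div P mod (2 * m)"
  define i where "i = phase z div P"
  define u where "u = tail z"
  define v where "v = head z"
  define y where "y = edge_code n u v"
  have mp: "0 < m" using m_pos[OF z] .
  have q: "q < 2 * m" using mp by (simp add: q_def)
  \<comment> \<open>Flipping the last bit of a number below the even number \<open>2 * m\<close>
    stays below it.\<close>
  have q': "Suc q - 2 * (q mod 2) < 2 * m"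
  proof (cases "even q")
    case True
    then obtain h where "q = 2 * h" by blast
    with q show ?thesis by simp
  qed (use q in presburger)
  have uv: "u < n" "v < n" using tail_less[OF z] head_less[OF z] by (simp_all add: u_def v_def)
  have y: "y < R" using edge_code_less[OF uv] by (simp add: y_def R_def)
  have yeq: "Suc ((u + v) * (n * n) + u * v) = y" by (simp add: y_def edge_code_def)
  have e: "inp (5 + q) = u" "inp (5 + (Suc q - 2 * (q mod 2))) = v"
    using inp_edge[OF q] inp_edge[OF q'] by (simp_all add: u_def v_def tail_def head_def q_def)
  have "2 * (q mod 2) \<le> Suc q" by presburger
  then have q6: "6 + q - 2 * (q mod 2) = 5 + (Suc q - 2 * (q mod 2))" by simp
  have e6: "inp (6 + q - 2 * (q mod 2)) = v" unfolding q6 by (rule e)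
  have ph: "phase z < k * P" "0 < i" "i < k" "source z < k * P * n" "target z < k * P * n"
    using phase_bounds[OF z] layer_bounds[OF z] source_props[OF z] target_props[OF z]
    by (simp_all add: i_def)
  have src: "((i - Suc 0) * P + z mod P) * n + u = source z"
    by (simp add: source_def i_def u_def)
  have tgt: "phase z * n + v = target z" by (simp add: target_def v_def)
  have sy': "Suc (source z * R + ((u + v) * (n * n) + u * v)) = source z * R + y"
    using yeq by simp
  have "source z * R + y < k * P * n * R" using ph(4) y by (rule row_index_less)
  then have sy: "source z * R + y < 2 ^ w" "source z * R < 2 ^ w" using w_R by linarith+
  have ye: "(u + v) * (n * n) < 2 ^ w" "u * v < 2 ^ w" "(u + v) * (n * n) + u * v < 2 ^ w" "y < 2 ^ w"
    using yeq y bounds_w(5) by linarith+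
  have "u + v \<le> (u + v) * (n * n)" using n_pos by simp
  then have uv2: "u + v < 2 ^ w" using ye(1) by (rule le_less_trans)
  have zw: "z < 2 ^ w" "z div P < 2 ^ w" "z mod P < 2 ^ w" "P < 2 ^ w"
    using z(2) w_z div_le_dividend[of z P] mod_le_divisor[of P z] P_pos bounds_w by linarith+
  have "phase z mod P < P" using P_pos by simp
  then have phw: "phase z < 2 ^ w" "i < 2 ^ w" "phase z mod P < 2 ^ w" "i - Suc 0 < 2 ^ w"
    using ph bounds_w by linarith+
  have mw: "5 + 2 * m < 2 ^ w" using length_xs_ge(1) w_in by simp
  then have qw: "5 + q < 2 ^ w" "q < 2 ^ w" "Suc q < 2 ^ w" "5 + (Suc q - 2 * (q mod 2)) < 2 ^ w"
    "Suc q - 2 * (q mod 2) < 2 ^ w" "2 * m < 2 ^ w"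
    using q q' by linarith+
  have qw6: "6 + q - 2 * (q mod 2) < 2 ^ w" unfolding q6 by (rule qw(4))
  have q2: "q mod 2 < 2 ^ w" "2 * (q mod 2) < 2 ^ w"
    using small_less[of "q mod 2"] small_less[of "2 * (q mod 2)"] by simp_all
  have "((i - Suc 0) * P + z mod P) * n + u < 2 ^ w" using ph bounds_w src by simp
  moreover have "(i - Suc 0) * P + z mod P \<le> ((i - Suc 0) * P + z mod P) * n" using n_pos by simp
  ultimately have srcw: "((i - Suc 0) * P + z mod P) * n < 2 ^ w" "(i - Suc 0) * P + z mod P < 2 ^ w"
      "(i - Suc 0) * P < 2 ^ w" "source z < 2 ^ w"
    using src by linarith+
  have "target z < 2 ^ w" using ph bounds_w by linarith
  then have tgtw: "target z < 2 ^ w" "phase z * n < 2 ^ w" using tgt by linarith+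
  have uvw: "u < 2 ^ w" "v < 2 ^ w" using uv bounds_w by linarith+
  have pz: "z div P div (2 * m) = phase z" by (simp add: phase_def)
  \<comment> \<open>Entries of \<open>D\<close> and \<open>M\<close> are at most 1, so the product
    is 0 or 1 and acts as a conjunction.\<close>
  define ok where "ok = D (source z) * (Suc 0 - D (target z)) * (Suc 0 - M (source z * R + y))"
  have cases: "D (source z) = 0 \<or> D (source z) = 1" "D (target z) = 0 \<or> D (target z) = 1"
      "M (source z * R + y) = 0 \<or> M (source z * R + y) = 1"
    using arr(3)[of "source z"] arr(3)[of "target z"] arr(4)[of "source z * R + y"] by linarith+
  have "D (source z) \<le> 1" "D (target z) \<le> 1" "M (source z * R + y) \<le> 1"
      "Suc 0 - D (target z) \<le> 1" "Suc 0 - M (source z * R + y) \<le> 1"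
      "D (source z) * (Suc 0 - D (target z)) \<le> 1" "ok \<le> 1"
    using cases by (auto simp: ok_def)
  then have okw: "D (source z) < 2 ^ w" "D (target z) < 2 ^ w" "M (source z * R + y) < 2 ^ w"
      "Suc 0 - D (target z) < 2 ^ w" "Suc 0 - M (source z * R + y) < 2 ^ w"
      "D (source z) * (Suc 0 - D (target z)) < 2 ^ w" "ok < 2 ^ w"
    using small_less[of 1] by linarith+
  have ok: "ok \<le> 1" "ok \<noteq> 0 \<longleftrightarrow> D (source z) \<noteq> 0 \<and> D (target z) = 0 \<and> M (source z * R + y) = 0"
    using cases by (auto simp: ok_def)
  have regs: "fst \<sigma> rn = n" "fst \<sigma> rP = P" "fst \<sigma> rnn = n * n" "fst \<sigma> rR = R" "snd \<sigma> aIn = inp"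
    using par by (simp_all add: params_def)
  note sm = small_less[of 0] small_less[of 1] small_less[of 2] small_less[of 5]
  have "wp w decode \<sigma> (\<lambda>T \<tau>. T \<le> 140 \<and> snd \<tau> = snd \<sigma> \<and> fst \<tau> = (fst \<sigma>)(rq := q, rph := phase z,
      ri := i, ru := u, rv := v, rsrc := source z, rtgt := target z, ry := y, rok := ok,
      rx := phase z mod P))"
    unfolding decode_def using sm
    by (simp add: regs reg arr q_def[symmetric] pz i_def[symmetric] e src tgt
      yeq sy sy' e6 qw6 ye uv2 zw phw qw q2 srcw tgtw uvw bounds_w nn_less okw ok_def[symmetric])
  then show ?thesis
  proof (rule wp_mono)
    fix T :: nat and \<tau> assume *: "T \<le> 140 \<and> snd \<tau> = snd \<sigma> \<and> fst \<tau> = (fst \<sigma>)(rq := q, rph := phase z,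
      ri := i, ru := u, rv := v, rsrc := source z, rtgt := target z, ry := y, rok := ok,
      rx := phase z mod P)"
    then show "Q T \<tau>"
      using ok par reg by (intro Q) (simp_all add: params_def i_def u_def v_def y_def)
  qed
qed

lemma wp_main_body:
  assumes par: "params \<sigma>" and reg: "fst \<sigma> rmm = 2 * m" "fst \<sigma> rz = z" "fst \<sigma> rlim = k * z\<^sub>0"
    and z: "z\<^sub>0 \<le> z" "z < k * z\<^sub>0"
    and inv: "table_inv (snd \<sigma> aD) (snd \<sigma> aL) (snd \<sigma> aM) z"
    and ans: "fst \<sigma> ans = (if \<exists>r. snd \<sigma> aD r \<noteq> 0 \<and> r mod n = t then 1 else 0)"
  shows "wp w main_body \<sigma> (\<lambda>T \<tau>. T \<le> 200 + (P + 1) * 62 + (p + 1) * 40 \<and> fst \<tau> rz = Suc z \<and>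
    params \<tau> \<and> fst \<tau> rmm = 2 * m \<and> fst \<tau> rlim = k * z\<^sub>0 \<and>
    table_inv (snd \<tau> aD) (snd \<tau> aL) (snd \<tau> aM) (Suc z) \<and>
    fst \<tau> ans = (if \<exists>r. snd \<tau> aD r \<noteq> 0 \<and> r mod n = t then 1 else 0))" (is "wp w _ _ ?Q")
proof -
  define D where "D = snd \<sigma> aD"
  define L where "L = snd \<sigma> aL"
  define M where "M = snd \<sigma> aM"
  define i where "i = phase z div P"
  note inv' = inv[folded D_def L_def M_def]
  have bounds: "D q \<le> 1" "L q < R" "M q \<le> 1" for q using inv' by (simp_all add: table_inv_def)
  have ph: "i < k" "source z < k * P * n" "target z < k * P * n" "head z < n" "phase z mod P < P"
    using layer_bounds[OF z] source_props[OF z] target_props[OF z] head_less[OF z] P_pos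
    by (simp_all add: i_def)
  \<comment> \<open>Every entry of \<open>L\<close> is below \<open>R\<close>, the range in which
    \<open>F\<close> decides membership in \<open>del_codes\<close>; so the climb tests exactly the
    condition on avoided edges.\<close>
  have adm: "admissible D L M z \<longleftrightarrow>
      D (source z) \<noteq> 0 \<and> M (source z * R + edge_code n (tail z) (head z)) = 0 \<and>
      (\<forall>b\<in>branches p (phase z mod P). climb_ok L M i (head z) (source z) b)"
  proof -
    have "y \<notin> del_codes (head z) \<longleftrightarrow> F (head z * R + y) = 0" if "y \<noteq> 0" "y < R" for y
      using F_eq[OF ph(4), of y] that by (cases "y \<in> del_codes (head z)") simp_all
    then have Fy: "y \<noteq> 0 \<and> M (source z * R + y) = 0 \<and> y \<notin> del_codes (head z) \<longleftrightarrow>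
        y \<noteq> 0 \<and> M (source z * R + y) = 0 \<and> F (head z * R + y) = 0" if "y < R" for y
      using that by blast
    have "(\<forall>y\<in>avoided L (target z). y \<noteq> 0 \<and> M (source z * R + y) = 0 \<and> y \<notin> del_codes (head z)) \<longleftrightarrow>
        (\<forall>b\<in>branches p (phase z mod P). climb_ok L M i (head z) (source z) b)"
      unfolding avoided_def target_props(1,2)[OF z] ball_simps climb_ok_def Let_def i_def[symmetric]
      by (intro ball_cong refl) (simp add: case_prod_beta Fy bounds(2) del: neq0_conv)
    then show ?thesis by (simp add: admissible_def)
  qed
  have zw: "Suc z < 2 ^ w" "z < 2 ^ w" using z(2) w_z by linarith+
  have sm: "0 < (2::nat) ^ w" "Suc 0 < 2 ^ w" using small_less[of 1] by simp_all
  have pw: "2 \<le> (2::nat) ^ w" using sm by linarith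
  show ?thesis unfolding main_body_def wp_Seq
  proof (rule wp_decode[OF par reg(1,2) z, where D = D and M = M])
    fix T1 :: nat and \<rho>
    assume T1: "T1 \<le> 140" and \<rho>: "params \<rho>" "snd \<rho> = snd \<sigma>" "fst \<rho> rmm = 2 * m" "fst \<rho> rz = z"
      "fst \<rho> rlim = fst \<sigma> rlim" "fst \<rho> ans = fst \<sigma> ans" "fst \<rho> ri = phase z div P"
      "fst \<rho> rv = head z" "fst \<rho> rsrc = source z" "fst \<rho> rtgt = target z"
      "fst \<rho> rx = phase z mod P" "fst \<rho> rok \<le> 1"
      and ok1: "fst \<rho> rok \<noteq> 0 \<longleftrightarrow> D (source z) \<noteq> 0 \<and> D (target z) = 0 \<and>
        M (source z * R + edge_code n (tail z) (head z)) = 0"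
    show "wp w (While (Reg rx) climb_body) \<rho> (\<lambda>T2 \<rho>. wp w (If (Reg rok) new_row Skip) \<rho>
        (\<lambda>T3 \<rho>. wp w (Assign rz (Reg rz [+] Const 1)) \<rho> (\<lambda>T4. ?Q (T1 + (T2 + (T3 + T4))))))"
    proof (rule wp_climb[OF \<rho>(1) \<rho>(7)[folded i_def] \<rho>(8,9,11,12) ph(1,4,2,5), where L = L and M = M])
      show "snd \<rho> aL = L" "snd \<rho> aM = M" by (simp_all add: \<rho>(2) L_def M_def)
      show "L q < R" "M q \<le> 1" for q using bounds by simp_all
      fix T2 :: nat and \<theta>
      assume T2: "T2 \<le> (P + 1) * 62" and par\<theta>: "params \<theta>"
        and fr: "\<forall>r. r \<noteq> rx \<and> r \<noteq> ry \<and> r \<noteq> rok \<longrightarrow> fst \<theta> r = fst \<rho> r" and s\<theta>: "snd \<theta> = snd \<rho>"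
        and ok\<theta>: "fst \<theta> rok \<le> 1"
        and ok2: "fst \<theta> rok \<noteq> 0 \<longleftrightarrow> fst \<rho> rok \<noteq> 0 \<and>
          (\<forall>b\<in>branches p (phase z mod P). climb_ok L M i (head z) (source z) b)"
      have ok: "fst \<theta> rok \<noteq> 0 \<longleftrightarrow> admissible D L M z \<and> D (target z) = 0"
        unfolding ok2 ok1 adm by blast
      have \<theta>: "fst \<theta> rmm = 2 * m" "fst \<theta> rz = z" "fst \<theta> rlim = k * z\<^sub>0" "fst \<theta> ans = fst \<sigma> ans"
          "fst \<theta> ri = i" "fst \<theta> rv = head z" "fst \<theta> rsrc = source z" "fst \<theta> rtgt = target z"
        using fr \<rho> reg by (simp_all add: i_def)
      have s\<theta>': "snd \<theta> = snd \<sigma>" using s\<theta> \<rho>(2) by simp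
      show "wp w (If (Reg rok) new_row Skip) \<theta>
          (\<lambda>T3 \<rho>. wp w (Assign rz (Reg rz [+] Const 1)) \<rho> (\<lambda>T4. ?Q (T1 + (T2 + (T3 + T4)))))"
      proof (cases "fst \<theta> rok = 0")
        case True
        then have "table_inv D L M (Suc z)" using ok by (intro table_inv_skip[OF inv']) blast
        then show ?thesis
          using True T1 T2 par\<theta> \<theta> s\<theta>' ans zw sm
          by (simp add: D_def L_def M_def params_def)
      next
        case False
        then have a: "admissible D L M z" "D (target z) = 0" using ok by simp_all
        have okw: "fst \<theta> rok < 2 ^ w" using ok\<theta> pw by linarith
        have "wp w new_row \<theta> (\<lambda>T3 \<rho>. wp w (Assign rz (Reg rz [+] Const 1)) \<rho>
            (\<lambda>T4. ?Q (T1 + (T2 + (1 + cost (Reg rok) + T3 + T4)))))"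
        proof (rule wp_new_row[OF par\<theta> \<theta>(5-8) ph(1,4,2,3), where D = D and L = L and M = M])
          show "snd \<theta> aD = D" "snd \<theta> aL = L" "snd \<theta> aM = M"
            by (simp_all add: s\<theta>' D_def L_def M_def)
          show "L q < R" for q by (rule bounds)
          fix T3 :: nat and \<tau>
          assume T3: "T3 \<le> (p + 1) * 40 + 20" and par\<tau>: "params \<tau>"
            and fr': "\<forall>r. r \<noteq> ans \<and> r \<noteq> rd \<and> r \<noteq> ry \<longrightarrow> fst \<tau> r = fst \<theta> r"
            and ans': "fst \<tau> ans = (if head z = t then 1 else fst \<theta> ans)"
            and arr: "snd \<tau> aD = D(target z := 1)"
              "snd \<tau> aL = new_L L i (head z) (source z) (target z) p"
              "snd \<tau> aM = new_M L M i (head z) (source z) (target z) p"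
          have \<tau>: "fst \<tau> rmm = 2 * m" "fst \<tau> rz = z" "fst \<tau> rlim = k * z\<^sub>0"
            using fr' \<theta> by simp_all
          have 1: "table_inv (snd \<tau> aD) (snd \<tau> aL) (snd \<tau> aM) (Suc z)"
            unfolding arr i_def by (rule table_inv_new[OF z inv' a])
          have "(D(target z := 1)) r \<noteq> 0 \<longleftrightarrow> r = target z \<or> D r \<noteq> 0" for r by simp
          then have "(\<exists>r. snd \<tau> aD r \<noteq> 0 \<and> r mod n = t) \<longleftrightarrow> head z = t \<or> (\<exists>r. D r \<noteq> 0 \<and> r mod n = t)"
            unfolding arr using target_props(2)[OF z] by metis
          then have 2: "fst \<tau> ans = (if \<exists>r. snd \<tau> aD r \<noteq> 0 \<and> r mod n = t then 1 else 0)"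
            using ans' \<theta>(4) ans by (simp add: D_def)
          have 3: "params ((fst \<tau>)(rz := Suc z), snd \<tau>)" using par\<tau> by (simp add: params_def)
          show "wp w (Assign rz (Reg rz [+] Const 1)) \<tau>
              (\<lambda>T4. ?Q (T1 + (T2 + (1 + cost (Reg rok) + T3 + T4))))"
            using 1 2 3 \<tau> T1 T2 T3 zw sm by simp
        qed
        then show ?thesis using False okw by simp
      qed
    qed
  qed (simp_all only: D_def[symmetric] M_def[symmetric] bounds)
qed

lemma wp_main_loop:
  assumes par: "params \<sigma>"
    and inv: "table_inv (snd \<sigma> aD) (snd \<sigma> aL) (snd \<sigma> aM) z\<^sub>0"
    and ans: "fst \<sigma> ans = (if \<exists>r. snd \<sigma> aD r \<noteq> 0 \<and> r mod n = t then 1 else 0)"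
    and Q: "\<And>T \<tau>. T \<le> (k * z\<^sub>0 - z\<^sub>0 + 1) * (204 + (P + 1) * 62 + (p + 1) * 40) + 40 \<Longrightarrow>
      fst \<tau> ans = (if has_short_conforming_path {..<n} E f s t k then 1 else 0) \<Longrightarrow> Q T \<tau>"
  shows "wp w main_loop \<sigma> Q"
proof -
  define I where "I z \<tau> \<longleftrightarrow> params \<tau> \<and> fst \<tau> rmm = 2 * m \<and> fst \<tau> rlim = k * z\<^sub>0 \<and>
    table_inv (snd \<tau> aD) (snd \<tau> aL) (snd \<tau> aM) z \<and>
    fst \<tau> ans = (if \<exists>r. snd \<tau> aD r \<noteq> 0 \<and> r mod n = t then 1 else 0)" for z \<tau>
  \<comment> \<open>For \<open>k = 1\<close> both sides agree: the loop body never runs and the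
    first row decides alone.\<close>
  have z0: "z\<^sub>0 \<le> k * z\<^sub>0" using k by simp
  have "P * (2 * m) \<le> z\<^sub>0" using P_pos by (simp add: z\<^sub>0_def)
  moreover have "2 * m < 2 ^ w" "m < 2 ^ w" using length_xs_ge(1) w_in by linarith+
  ultimately have wz: "z\<^sub>0 < 2 ^ w" "P * (2 * m) < 2 ^ w" "2 * m < 2 ^ w" "m < 2 ^ w"
    using w_z z0 by linarith+
  note par' = par[unfolded params_def]
  show ?thesis unfolding main_loop_def
    using small_less[of 2] bounds_w wz w_z par'
    apply (simp add: z\<^sub>0_def[symmetric])
    apply (rule wp_For[where r = rz and I = I and N = "k * z\<^sub>0" and a = z\<^sub>0
          and B = "200 + (P + 1) * 62 + (p + 1) * 40"])
    subgoal by simp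
    subgoal by (rule z0)
    subgoal using inv ans by (simp add: I_def params_def)
    subgoal by (simp add: I_def)
    subgoal unfolding I_def by (rule wp_main_body) simp_all
    subgoal using w by simp
    subgoal for \<tau> T
      using table_correct[of "snd \<tau> aD" "snd \<tau> aL" "snd \<tau> aM"] by (intro Q) (simp_all add: I_def)
    done
qed

lemma wp_solver:
  "wp w solver (initial_state xs) (\<lambda>T \<tau>.
     fst \<tau> ans = (if has_short_conforming_path {..<n} E f s t k then 1 else 0) \<and>
     T \<le> 20 + ((n + 1) * 40 + 20) + ((k + 1) * 24 + 40) + ((n * \<mu>' + 1) * 100 + 20) +
       ((p + 1) * 40 + 40) + ((k * z\<^sub>0 - z\<^sub>0 + 1) * (204 + (P + 1) * 62 + (p + 1) * 40) + 40))"
  unfolding solver_def wp_Seq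
  by (rule wp_read_header, rule wp_scan, assumption, assumption,
      rule wp_parameters, assumption, assumption, rule wp_fill, assumption+, simp,
      rule wp_first_row, assumption+, rule wp_main_loop, assumption+) linarith

end

section \<open>Resource bounds\<close>

context instance_data
begin

text \<open>This is \<open>2 powr L\<close> for the \<open>L\<close> of the theorem, the unit in
  which all quantities depending on \<open>k\<close> and \<open>\<mu>\<close> are measured.\<close>

definition "Z = (k * max (max_deletions {..<n} f) 2) ^ k"
definition "N = max n 2"

lemma Z_ge: "k * max (max_deletions {..<n} f) 2 \<le> Z"
proof -
  have "k * max (max_deletions {..<n} f) 2 = (k * max (max_deletions {..<n} f) 2) ^ 1" by simp
  also have "\<dots> \<le> Z" unfolding Z_def using k by (intro power_increasing) auto
  finally show ?thesis .
qed

lemma parameter_bounds: "2 \<le> Z" "k \<le> Z" "\<mu>' \<le> Z\<^sup>2" "p + 1 \<le> Z\<^sup>2" "P \<le> Z\<^sup>2"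
proof -
  define x where "x = k * max (max_deletions {..<n} f) 2"
  have x: "2 * k \<le> x" "k * max_deletions {..<n} f \<le> x" unfolding x_def by simp_all
  show Z2: "2 \<le> Z" using x(1) k Z_ge unfolding x_def by linarith
  show "k \<le> Z" using x(1) Z_ge unfolding x_def by linarith
  \<comment> \<open>The maximum with 2 gives \<open>2 * k \<le> x\<close>, hence
    \<open>p + 1 \<le> 2 * x \<le> x * x\<close>. Passing from the base \<open>x\<close> to
    \<open>p + 1\<close> thus costs a square, and \<open>P\<close> is at most the square of
    \<open>Z\<close>.\<close>
  have "p + 1 = k * max_deletions {..<n} f + k + 1" by (simp add: p_def \<mu>'_def)
  also have "\<dots> \<le> 2 * x" using x k by linarith
  also have "\<dots> \<le> x * x" using x k by (intro mult_right_mono) linarith+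
  finally have px: "p + 1 \<le> x\<^sup>2" by (simp add: power2_eq_square)
  have "P \<le> (x\<^sup>2) ^ k" unfolding P_def using px by (rule power_mono) simp
  then show "P \<le> Z\<^sup>2" by (simp add: Z_def x_def[symmetric] power_mult[symmetric] mult.commute)
  have "x\<^sup>2 \<le> Z\<^sup>2" using Z_ge unfolding x_def by (rule power_mono) simp
  then show "p + 1 \<le> Z\<^sup>2" using px by linarith
  moreover have "\<mu>' \<le> p" unfolding p_def using k by simp
  ultimately show "\<mu>' \<le> Z\<^sup>2" by linarith
qed

lemma m_eq_card: "m = card E"
  using es unfolding lists_edges_def m_def by (metis distinct_card length_map)

lemma m_le: "m \<le> n * n"
proof -
  have "E \<subseteq> (\<lambda>(a, b). {a, b}) ` ({..<n} \<times> {..<n})"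
  proof
    fix e assume e: "e \<in> E"
    then have "card e = 2" using graph by (simp add: simple_graph_def)
    then obtain a b where "e = {a, b}" by (auto simp: card_2_iff)
    moreover from this e have "a < n" "b < n" using edge_bounds by blast+
    ultimately show "e \<in> (\<lambda>(a, b). {a, b}) ` ({..<n} \<times> {..<n})" by auto
  qed
  then have "m \<le> card ((\<lambda>(a, b). {a, b}) ` ({..<n} \<times> {..<n}))"
    unfolding m_eq_card by (intro card_mono) auto
  also have "\<dots> \<le> card ({..<n} \<times> {..<n})" by (rule card_image_le) simp
  finally show ?thesis by simp
qed

text \<open>All products are at most \<open>Z ^ a * N ^ b\<close> with \<open>a, b \<le> 6\<close>;
  the extreme case is \<open>k * P * n * R\<close> with \<open>b = 6\<close>. The exponent 7 makes
  the inequalities strict.\<close>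

lemma size_bounds:
  defines "G \<equiv> Z * N"
  shows "length ([n, length es, s, t, k] @ flatten es @
      concat (map (\<lambda>ps. length ps # flatten ps) fs)) < G ^ 7"
    and "k * P * n * R < G ^ 7" and "k * P * n * p < G ^ 7" and "k * z\<^sub>0 < G ^ 7" and "n * \<mu>' < G ^ 7"
proof -
  note pb = parameter_bounds
  have N: "2 \<le> N" "n \<le> N" by (simp_all add: N_def)
  have G: "4 \<le> G" unfolding G_def using mult_le_mono[OF pb(1) N(1)] by simp
  have ZG: "Z \<le> G" "N \<le> G" unfolding G_def using pb(1) N(1) by simp_all
  have Zp: "Z ^ a * N ^ b \<le> G ^ 6" if "a \<le> 6" "b \<le> 6" for a b
  proof -
    have "Z ^ a * N ^ b \<le> Z ^ 6 * N ^ 6"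
      using that pb(1) N(1) by (intro mult_le_mono power_increasing) simp_all
    then show ?thesis by (simp add: G_def power_mult_distrib)
  qed
  have G67: "x < G ^ 7" if "x \<le> G ^ 6" for x
  proof -
    have "G ^ 6 < G ^ 7" using G by (intro power_strict_increasing) simp_all
    with that show ?thesis by simp
  qed
  have mN: "m \<le> N\<^sup>2" using m_le mult_le_mono[OF N(2,2)] by (simp add: power2_eq_square)
  have "n * \<mu>' \<le> N * Z\<^sup>2" using N(2) pb(3) by (rule mult_le_mono)
  then show "n * \<mu>' < G ^ 7" using Zp[of 2 1] by (intro G67) (simp add: mult.commute)
  have "k * P * n * p \<le> Z * Z\<^sup>2 * N * Z\<^sup>2" using pb N(2) by (intro mult_le_mono) simp_all
  also have "\<dots> = Z ^ 5 * N ^ 1" by (simp add: eval_nat_numeral)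
  finally show "k * P * n * p < G ^ 7" using Zp[of 5 1] by (intro G67) simp
  \<comment> \<open>One factor \<open>N\<close> absorbs the constant 2, another one the summand
    1.\<close>
  have "R \<le> N ^ 5"
  proof -
    have "2 * n * n * n \<le> N * N * N * N" using N by (intro mult_le_mono)
    moreover have "1 \<le> N * N * N * N" using N by simp
    moreover have "2 * (N * N * N * N) \<le> N * (N * N * N * N)" using N by (intro mult_right_mono) simp_all
    ultimately have "2 * n * n * n + 1 \<le> N * (N * N * N * N)" by linarith
    then show ?thesis by (simp add: R_def eval_nat_numeral mult.assoc)
  qed
  then have "k * P * n * R \<le> Z * Z\<^sup>2 * N * N ^ 5" using pb N(2) by (intro mult_le_mono) simp_all
  also have "\<dots> = Z ^ 3 * N ^ 6" by (simp add: eval_nat_numeral)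
  finally show "k * P * n * R < G ^ 7" using Zp[of 3 6] by (intro G67) simp
  have "k * z\<^sub>0 \<le> Z * (Z\<^sup>2 * (N * N\<^sup>2) * Z\<^sup>2)"
    unfolding z\<^sub>0_def using pb N(1) mN by (intro mult_le_mono) simp_all
  also have "\<dots> = Z ^ 5 * N ^ 3" by (simp add: eval_nat_numeral)
  finally show "k * z\<^sub>0 < G ^ 7" using Zp[of 5 3] by (intro G67) simp
  have "length (concat (map (\<lambda>ps. length ps # flatten ps) fs)) = (\<Sum>v<n. 1 + 2 * length (fs ! v))"
    by (simp add: length_concat comp_def sum_list_sum_nth length_fs atLeast0LessThan length_flatten)
  also have "\<dots> \<le> (\<Sum>v<n. 2 * \<mu>')" using length_fs_less by (intro sum_mono) fastforce
  also have "\<dots> = 2 * (n * \<mu>')" by simp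
  finally have "length ([n, length es, s, t, k] @ flatten es @
      concat (map (\<lambda>ps. length ps # flatten ps) fs)) \<le> 5 + 2 * m + 2 * (n * \<mu>')"
    by (simp add: m_def length_flatten)
  also have "\<dots> \<le> G ^ 2 + G ^ 3 + G ^ 4"
  proof -
    have "4 * 4 \<le> G * G" using G by (intro mult_le_mono)
    then have "5 \<le> G ^ 2" by (simp add: power2_eq_square)
    moreover have "2 * m \<le> G * G\<^sup>2"
      using mN power_mono[OF ZG(2), of 2] G by (intro mult_le_mono) linarith+
    moreover have "2 * (n * \<mu>') \<le> G * (G * G\<^sup>2)"
      using N(2) ZG(2) pb(3) power_mono[OF ZG(1), of 2] G by (intro mult_le_mono) linarith+
    ultimately show ?thesis by (simp add: eval_nat_numeral)
  qed
  also have "\<dots> \<le> G ^ 4 + G ^ 4 + G ^ 4"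
    using G by (intro add_mono power_increasing) simp_all
  also have "\<dots> \<le> G * G ^ 4" 
  proof -
    have "4 * G ^ 4 \<le> G * G ^ 4" using G by (intro mult_right_mono) simp_all
    then show ?thesis by linarith
  qed
  also have "\<dots> = G ^ 5" by (simp add: eval_nat_numeral)
  also have "\<dots> \<le> G ^ 6" using G by (intro power_increasing) simp_all
  finally show "length ([n, length es, s, t, k] @ flatten es @
      concat (map (\<lambda>ps. length ps # flatten ps) fs)) < G ^ 7" by (rule G67)
qed

text \<open>The main loop accounts for the exponents: at most of order
  \<open>(n + m) * Z ^ 5\<close> rounds, each of order \<open>Z\<^sup>2\<close>. It is linear in the
  graph because a position fixes one oriented edge, and both vertices come with it.\<close>

lemma time_bound:
  "20 + ((n + 1) * 40 + 20) + ((k + 1) * 24 + 40) + ((n * \<mu>' + 1) * 100 + 20) +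
    ((p + 1) * 40 + 40) + ((k * z\<^sub>0 - z\<^sub>0 + 1) * (204 + (P + 1) * 62 + (p + 1) * 40) + 40)
   \<le> (n + m) * Z ^ 18"
proof -
  note pb = parameter_bounds
  define S where "S = n + m"
  define B where "B = S * Z ^ 7"
  have S: "1 \<le> S" "n \<le> S" "m \<le> S" using n_pos by (simp_all add: S_def)
  have Z1: "1 \<le> Z ^ a" for a using pb(1) by simp
  have Zp: "x * Z ^ a \<le> B" if "x \<le> S" "a \<le> 7" for a x
    unfolding B_def using that pb(1) by (intro mult_le_mono power_increasing) simp_all
  have b1: "1 \<le> B" using Zp[of 1 0] S by simp
  have bn: "n \<le> B" using Zp[of n 0] S by simp
  have bk: "k \<le> B" using Zp[of 1 1] S pb(2) by simp
  have "n * \<mu>' \<le> n * Z\<^sup>2" using pb(3) by simp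
  then have bm: "n * \<mu>' \<le> B" using Zp[of n 2] S by linarith
  have bp: "p + 1 \<le> B" using Zp[of 1 2] S pb(4) by simp
  have z: "k * z\<^sub>0 - z\<^sub>0 + 1 \<le> 3 * (S * Z ^ 5)"
  proof -
    have "k * z\<^sub>0 \<le> Z * (Z\<^sup>2 * (2 * S) * Z\<^sup>2)"
      unfolding z\<^sub>0_def using pb S by (intro mult_le_mono) simp_all
    also have "\<dots> = 2 * (S * Z ^ 5)" by (simp add: eval_nat_numeral algebra_simps)
    finally have "k * z\<^sub>0 \<le> 2 * (S * Z ^ 5)" .
    moreover have "1 \<le> S * Z ^ 5" using mult_le_mono[OF S(1) Z1[of 5]] by simp
    ultimately show ?thesis by linarith
  qed
  \<comment> \<open>368 is \<open>204 + 2 * 62 + 40\<close>, by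
    \<open>P + 1 \<le> 2 * Z\<^sup>2\<close>; the 1104 below is three times that.\<close>
  have "204 + (P + 1) * 62 + (p + 1) * 40 \<le> 368 * Z\<^sup>2"
    using pb(4,5) Z1[of 2] by simp
  with z have "(k * z\<^sub>0 - z\<^sub>0 + 1) * (204 + (P + 1) * 62 + (p + 1) * 40) \<le>
      3 * (S * Z ^ 5) * (368 * Z\<^sup>2)" by (rule mult_le_mono)
  also have "\<dots> = 1104 * B" by (simp add: B_def power_add[symmetric])
  finally have main: "(k * z\<^sub>0 - z\<^sub>0 + 1) * (204 + (P + 1) * 62 + (p + 1) * 40) \<le> 1104 * B" .
  \<comment> \<open>2048 is a power of 2 above the sum of all coefficients. As
    \<open>2 \<le> Z\<close>, it is at most \<open>Z ^ 11\<close>, and \<open>7 + 11\<close> gives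
    the exponent 18.\<close>
  have sum: "20 + ((n + 1) * 40 + 20) + ((k + 1) * 24 + 40) + ((a + 1) * 100 + 20) +
      (b * 40 + 40) + (c + 40) \<le> 2048 * B" if "a \<le> B" "b \<le> B" "c \<le> 1104 * B" for a b c
    using that b1 bn bk by simp
  have "20 + ((n + 1) * 40 + 20) + ((k + 1) * 24 + 40) + ((n * \<mu>' + 1) * 100 + 20) +
    ((p + 1) * 40 + 40) + ((k * z\<^sub>0 - z\<^sub>0 + 1) * (204 + (P + 1) * 62 + (p + 1) * 40) + 40) \<le> 2048 * B"
    by (rule sum[OF bm bp main])
  also have "\<dots> \<le> Z ^ 11 * B"
    using power_mono[OF pb(1), of 11] by (intro mult_right_mono) simp_all
  also have "\<dots> = S * Z ^ 18" by (simp add: B_def power_add[symmetric] mult.left_commute)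
  finally show ?thesis by (simp add: S_def)
qed

end

theorem theorem25:
  "\<exists>(prog :: com) (C :: real). C > 0 \<and>
     (\<forall>V E f s t k input.
        self_deleting_graph V E f \<longrightarrow> s \<in> V \<longrightarrow> t \<in> V \<longrightarrow> k \<ge> 1 \<longrightarrow>
        encodes input V E f s t k \<longrightarrow>
        (let n = card V; m = card E; \<mu> = max_deletions V f;
             L = real k * log 2 (real k * real (max \<mu> 2));
             logn = log 2 (real (max n 2))
         in \<forall>w::nat. real w \<ge> C * (L + logn) \<longrightarrow>
              (\<exists>T \<tau>. exec w prog (initial_state input) T \<tau> \<and>
                 answer \<tau> = (if has_short_conforming_path V E f s t k then 1 else 0) \<and>
                 real T \<le> 2 powr (C * L) * real (n + m) * logn)))"
proof (intro exI[of _ solver] exI[of _ "18 :: real"] conjI allI impI)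
  fix V E f s t k input
  assume sdg: "self_deleting_graph V E f" and s: "s \<in> V" and t: "t \<in> V" and k: "k \<ge> 1"
    and enc: "encodes input V E f s t k"
  from enc obtain n es fs where V: "V = {..<n}" and es: "lists_edges es E" and fs: "length fs = n"
      "\<forall>v<n. lists_edges (fs ! v) (f v)"
      and input: "input = [n, length es, s, t, k] @ flatten es @
             concat (map (\<lambda>ps. length ps # flatten ps) fs)"
    unfolding encodes_def by blast
  interpret instance_data n es fs E f s t k
    using sdg s t k es fs by unfold_locales (simp_all add: V)
  define L where "L = real k * log 2 (real k * real (max (max_deletions V f) 2))"
  define logn where "logn = log 2 (real (max n 2))"
  have kpos: "0 < real k * real (max (max_deletions V f) 2)" using k by simp
  have "2 powr L = (2 powr log 2 (real k * real (max (max_deletions V f) 2))) powr real k"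
    by (simp add: L_def powr_powr mult.commute)
  also have "\<dots> = real Z"
    using kpos by (simp add: powr_realpow Z_def V)
  finally have ZL: "2 powr L = real Z" .
  have Nl: "2 powr logn = real N" by (simp add: logn_def N_def)
  have logn: "1 \<le> logn" unfolding logn_def by (simp add: le_log_iff)
  have "\<exists>T \<tau>. exec w solver (initial_state input) T \<tau> \<and>
      answer \<tau> = (if has_short_conforming_path V E f s t k then 1 else 0) \<and>
      real T \<le> 2 powr (18 * L) * real (n + m) * logn"
    if w: "real w \<ge> 18 * (L + logn)" for w
  proof -
    \<comment> \<open>The constant 18 comes from \<open>time_bound\<close>. It also provides the
      word length, since the bounds of \<open>size_bounds\<close> are powers with exponent
      \<open>7 \<le> 18\<close>.\<close>
    have "2 powr (18 * (L + logn)) = (2 powr L * 2 powr logn) powr 18"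
      by (simp add: powr_add[symmetric] powr_powr mult.commute)
    also have "\<dots> = real ((Z * N) ^ 18)"
      using parameter_bounds(1) by (simp add: ZL Nl N_def powr_realpow flip: powr_numeral)
    finally have "real ((Z * N) ^ 18) = 2 powr (18 * (L + logn))" by simp
    also have "\<dots> \<le> 2 powr real w" using w by simp
    also have "\<dots> = real (2 ^ w)" by (simp add: powr_realpow)
    finally have w18: "(Z * N) ^ 18 \<le> 2 ^ w" by (simp only: of_nat_le_iff)
    have ZN: "1 \<le> Z * N" using parameter_bounds(1) by (simp add: N_def)
    have "(Z * N) ^ 7 \<le> (Z * N) ^ 18" using ZN by (intro power_increasing) simp_all
    then have w7: "x < (Z * N) ^ 7 \<Longrightarrow> x < 2 ^ w" for x using w18 by linarith
    have "2 powr 0 \<le> 2 powr L" using parameter_bounds(1) by (simp add: ZL)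
    then have "0 \<le> L" by (subst (asm) powr_le_cancel_iff) simp_all
    then have "4 \<le> real w" using w logn by (simp add: algebra_simps)
    then have "4 \<le> w" by simp
    interpret machine n es fs E f s t k w input
      using input \<open>4 \<le> w\<close> size_bounds[THEN w7] by unfold_locales simp_all
    from wp_solver obtain T \<tau> where e: "exec w solver (initial_state input) T \<tau>"
      and a: "fst \<tau> 0 = (if has_short_conforming_path {..<n} E f s t k then 1 else 0)"
      and T: "T \<le> 20 + ((n + 1) * 40 + 20) + ((k + 1) * 24 + 40) + ((n * \<mu>' + 1) * 100 + 20) +
       ((p + 1) * 40 + 40) + ((k * z\<^sub>0 - z\<^sub>0 + 1) * (204 + (P + 1) * 62 + (p + 1) * 40) + 40)"
      by (auto elim!: wpE)
    have "real T \<le> real ((n + m) * Z ^ 18)"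
      using T time_bound by (simp only: of_nat_le_iff)
    also have "\<dots> = 2 powr (18 * L) * real (n + m)"
    proof -
      have "2 powr (18 * L) = (2 powr L) powr 18" by (simp add: powr_powr mult.commute)
      also have "\<dots> = real Z ^ 18"
        using parameter_bounds(1) by (simp add: ZL powr_realpow flip: powr_numeral)
      finally show ?thesis by simp
    qed
    also have "\<dots> \<le> 2 powr (18 * L) * real (n + m) * logn"
      using mult_left_mono[OF logn, of "2 powr (18 * L) * real (n + m)"] by simp
    finally show ?thesis using e a unfolding answer_def V by blast
  qed
  then show "let n = card V; m = card E; \<mu> = max_deletions V f;
             L = real k * log 2 (real k * real (max \<mu> 2));
             logn = log 2 (real (max n 2))
         in \<forall>w::nat. real w \<ge> 18 * (L + logn) \<longrightarrow>
              (\<exists>T \<tau>. exec w solver (initial_state input) T \<tau> \<and>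
                 answer \<tau> = (if has_short_conforming_path V E f s t k then 1 else 0) \<and>
                 real T \<le> 2 powr (18 * L) * real (n + m) * logn)"
    unfolding Let_def L_def logn_def m_eq_card by (simp add: V)
qed simp

end
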